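(* Let $m\ge2$, let $p$ be a prime with $p\equiv 1\pmod{m-1}$, $q$ an odd prime, and $p$ a quadratic residue modulo $q$. Let $V$ be an $m\times m$ matrix over $\mathbb{F}_p$ with $VV^T=\lambda I_m$ for some $\lambda\in\mathbb{F}_p^*$, and let $\Phi$ be the Gray map defined by $V$. Let $I=\{i_1,\dots,i_k\}$ be any nonempty subset of $\mathbb{A}=\{1,\dots,m\}$. If $q\equiv 3\pmod 4$, then the Gray image $\Phi(\overline{Q_I})$ of the extended QR-code $\overline{Q_I}$ is a self-dual code of length $m(q+1)$ over $\mathbb{F}_p$, and the Gray image $\Phi(S_I)$ of the even-like QR-code $S_I$ is a self-orthogonal code of length $mq$ over $\mathbb{F}_p$. If $q\equiv 1\pmod 4$, then $\Phi(\overline{Q_I})$ is a formally self-dual code of length $m(q+1)$ over $\mathbb{F}_p$.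
   Context: $\mathcal{R}=\mathbb{F}_p[u]/\langle u^m-u\rangle$. Let $\xi=\alpha^{(p-1)/(m-1)}$ with $\alpha$ a primitive element of $\mathbb{F}_p$ (so $\xi$ has order $m-1$). Put $\eta_1=1-u^{m-1}$ and, for $0\le j\le m-2$, $\eta_{j+2}=(m-1)^{-1}\sum_{k=1}^{m-1}(\xi^{j})^{k}u^k$. These satisfy $\eta_i^2=\eta_i$, $\eta_i\eta_j=0$ for $i\neq j$, and $\sum_{i=1}^m\eta_i=1$ in $\mathcal{R}$. Gray map: for $r(u)=a_0+a_1u+\cdots+a_{m-1}u^{m-1}\in\mathcal{R}$, $\Phi(r)=(r(0),r(1),r(\xi),\dots,r(\xi^{m-2}))\,V\in\mathbb{F}_p^m$ (row vector times matrix), extended componentwise to $\Phi:\mathcal{R}^n\to\mathbb{F}_p^{mn}$. Let $Q_q,N_q$ be the sets of quadratic residues and non-residues modulo $q$, $\zeta$ a primitive $q$th root of unity in an extension field of $\mathbb{F}_p$, $r(x)=\prod_{i\in Q_q}(x-\zeta^i)$, $n(x)=\prod_{i\in N_q}(x-\zeta^i)$ (polynomials over $\mathbb{F}_p$). In $\mathbb{F}_p[x]/\langle x^q-1\rangle$ let $d_1,d_2,e_1,e_2$ be the idempotent generators of the ideals $\langle r(x)\rangle$, $\langle n(x)\rangle$, $\langle (x-1)r(x)\rangle$, $\langle (x-1)n(x)\rangle$ respectively. Let $\mathcal{R}_q=\mathcal{R}[x]/\langle x^q-1\rangle$. For nonempty $I=\{i_1,\dots,i_k\}\subseteq\mathbb{A}$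 put $\eta_I=\eta_{i_1}+\cdots+\eta_{i_k}$ and $D_I=\eta_Id_1+(1-\eta_I)d_2$, $E_I=\eta_Ie_1+(1-\eta_I)e_2$ in $\mathcal{R}_q$. The quadratic residue codes are the ideals $Q_I=\langle D_I\rangle$ (odd-like) and $S_I=\langle E_I\rangle$ (even-like) of $\mathcal{R}_q$, identified with cyclic codes of length $q$ over $\mathcal{R}$ via coefficient vectors; one has $Q_I=S_I+\langle \frac1q h\rangle$ with $h=1+x+\cdots+x^{q-1}$. Extended code: with coordinates labelled $\infty,0,1,\dots,q-1$, $\overline{Q_I}$ is the $\mathcal{R}$-submodule of $\mathcal{R}^{q+1}$ generated by all vectors $(0,g)$, with $g$ a row of a generator matrix of $S_I$ (equivalently, $g\in S_I$), together with the vector $(r,1,1,\dots,1)$, where: if $q\equiv 3\pmod 4$, $r\in\mathbb{F}_p$ is an element with $r^2=-q$ in $\mathbb{F}_p$ (which exists since $p$ is a quadratic residue modulo $q$); if $q\equiv 1\pmod 4$, $r=1$. For a code $\mathcal{C}$ of length $n$ over $\mathcal{R}$ or $\mathbb{F}_p$, $\mathcal{C}^\perp$ is its dual for the Euclidean inner product; $\mathcal{C}$ is self-dual if $\mathcal{C}=\mathcal{C}^\perp$ and self-orthogonal if $\mathcal{C}\subseteq\mathcal{C}^\perp$. A linear code over $\mathbb{F}_p$ is formally self-dual if it and its dual have the same (Hamming) weight enumerator. *)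

theory Defs
  imports
    "Berlekamp_Zassenhaus.Finite_Field"
    "Jordan_Normal_Form.VS_Connect"
    "HOL-Number_Theory.Number_Theory"
begin

section \<open>The ring \<open>\<R> = F\<^sub>p[u]/\<langle>u^m - u\<rangle>\<close>\<close>

text \<open>\<open>F\<^sub>p\<close> is \<^typ>\<open>'p mod_ring\<close> with \<open>p = CARD('p)\<close>; the exponent \<open>m\<close> is \<open>CARD('m)\<close>, so that
  the quotient ring is a type.\<close>

definition u_modulus :: "'m::finite itself \<Rightarrow> 'a::comm_ring_1 poly" where
  "u_modulus _ = monom 1 CARD('m) - monom 1 1"

quotient_type (overloaded) ('p, 'm) gray_ring =
  "'p::prime_card mod_ring poly" / "\<lambda>f g. u_modulus TYPE('m::finite) dvd (f - g)"
proof (rule equivpI)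
  show "reflp (\<lambda>f g. u_modulus TYPE('m) dvd (f - g :: 'p mod_ring poly))"
    by (simp add: reflp_def)
  show "symp (\<lambda>f g. u_modulus TYPE('m) dvd (f - g :: 'p mod_ring poly))"
    unfolding symp_def by (metis dvd_minus_iff minus_diff_eq)
  show "transp (\<lambda>f g. u_modulus TYPE('m) dvd (f - g :: 'p mod_ring poly))"
  proof (rule transpI)
    fix f g h :: "'p mod_ring poly"
    assume "u_modulus TYPE('m) dvd f - g" "u_modulus TYPE('m) dvd g - h"
    then have "u_modulus TYPE('m) dvd (f - g) + (g - h)" by (rule dvd_add)
    then show "u_modulus TYPE('m) dvd f - h" by simp
  qed
qed

lemma mult_cong_dvd:
  fixes a b c d k :: "'a::comm_ring_1"
  assumes "k dvd a - b" "k dvd c - d"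
  shows "k dvd a * c - b * d"
proof -
  have "a * c - b * d = (a - b) * c + b * (c - d)" by (simp add: algebra_simps)
  then show ?thesis using assms by (simp add: dvd_add dvd_mult dvd_mult2)
qed

lemma add_cong_dvd:
  fixes a b c d k :: "'a::comm_ring_1"
  assumes "k dvd a - b" "k dvd c - d"
  shows "k dvd (a + c) - (b + d)" "k dvd (a - c) - (b - d)"
proof -
  have "(a + c) - (b + d) = (a - b) + (c - d)" by simp
  then show "k dvd (a + c) - (b + d)" using assms by (simp only: dvd_add)
  have "(a - c) - (b - d) = (a - b) - (c - d)" by simp
  then show "k dvd (a - c) - (b - d)" using assms by (simp only: dvd_diff)
qed

lemma uminus_cong_dvd:
  fixes a b k :: "'a::comm_ring_1"
  assumes "k dvd a - b"
  shows "k dvd (- a) - (- b)"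
  using add_cong_dvd(2)[of k 0 0 a b] assms by simp

lemma u_modulus_not_dvd_1: "\<not> u_modulus TYPE('m::finite) dvd (1 :: 'a::field poly)"
proof
  assume *: "u_modulus TYPE('m) dvd (1 :: 'a poly)"
  have "poly (u_modulus TYPE('m)) (0 :: 'a) = 0"
    by (simp add: u_modulus_def poly_monom)
  with * have "poly (1 :: 'a poly) 0 = 0" by (metis dvdE mult_zero_left poly_mult)
  then show False by simp
qed

instantiation gray_ring :: (prime_card, finite) comm_ring_1
begin

lift_definition zero_gray_ring :: "('a, 'b) gray_ring" is 0 .
lift_definition one_gray_ring :: "('a, 'b) gray_ring" is 1 .
lift_definition plus_gray_ring :: "('a, 'b) gray_ring \<Rightarrow> ('a, 'b) gray_ring \<Rightarrow> ('a, 'b) gray_ring"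
  is "(+)" by (rule add_cong_dvd)
lift_definition minus_gray_ring :: "('a, 'b) gray_ring \<Rightarrow> ('a, 'b) gray_ring \<Rightarrow> ('a, 'b) gray_ring"
  is "(-)" by (rule add_cong_dvd)
lift_definition uminus_gray_ring :: "('a, 'b) gray_ring \<Rightarrow> ('a, 'b) gray_ring"
  is uminus by (rule uminus_cong_dvd)
lift_definition times_gray_ring :: "('a, 'b) gray_ring \<Rightarrow> ('a, 'b) gray_ring \<Rightarrow> ('a, 'b) gray_ring"
  is "(*)" by (rule mult_cong_dvd)

instance
proof
  fix a b c :: "('a, 'b) gray_ring"
  show "a * b * c = a * (b * c)" by transfer (simp add: mult.assoc)
  show "a * b = b * a" by transfer (simp add: mult.commute)
  show "1 * a = a" by transfer simp
  show "a + b + c = a + (b + c)" by transfer (simp add: add.assoc)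
  show "a + b = b + a" by transfer (simp add: add.commute)
  show "0 + a = a" by transfer simp
  show "- a + a = 0" by transfer simp
  show "a - b = a + - b" by transfer simp
  show "(a + b) * c = a * c + b * c" by transfer (simp add: distrib_right)
  show "(0 :: ('a, 'b) gray_ring) \<noteq> 1"
    by transfer (simp only: diff_0 dvd_minus_iff u_modulus_not_dvd_1 not_False_eq_True)
qed

end

definition gray_ring_of_poly :: "'p::prime_card mod_ring poly \<Rightarrow> ('p, 'm::finite) gray_ring" where
  "gray_ring_of_poly = abs_gray_ring"

lemma gray_ring_of_poly_hom: "comm_ring_hom (gray_ring_of_poly :: _ \<Rightarrow> ('p::prime_card, 'm::finite) gray_ring)"
  unfolding gray_ring_of_poly_def
  by standard (simp_all add: zero_gray_ring.abs_eq one_gray_ring.abs_eq plus_gray_ring.abs_eq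
      times_gray_ring.abs_eq)

lemma gray_ring_of_poly_eq_iff:
  "gray_ring_of_poly f = (gray_ring_of_poly g :: ('p::prime_card, 'm::finite) gray_ring)
   \<longleftrightarrow> u_modulus TYPE('m) dvd (f - g)"
  unfolding gray_ring_of_poly_def by (simp add: gray_ring.abs_eq_iff)

definition gray_ring_const :: "'p::prime_card mod_ring \<Rightarrow> ('p, 'm::finite) gray_ring" where
  "gray_ring_const c = gray_ring_of_poly [:c:]"

lemma gray_ring_const_hom: "comm_ring_hom (gray_ring_const :: _ \<Rightarrow> ('p::prime_card, 'm::finite) gray_ring)"
proof -
  interpret comm_ring_hom "gray_ring_of_poly :: _ \<Rightarrow> ('p, 'm) gray_ring"
    by (rule gray_ring_of_poly_hom)
  have "gray_ring_of_poly [:a * b:] = gray_ring_of_poly [:a:] * (gray_ring_of_poly [:b:] :: ('p, 'm) gray_ring)"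
    for a b by (simp add: mult.commute flip: hom_mult)
  moreover have "gray_ring_of_poly [:a + b:] = gray_ring_of_poly [:a:] + (gray_ring_of_poly [:b:] :: ('p, 'm) gray_ring)"
    for a b by (simp flip: hom_add)
  moreover have "gray_ring_of_poly [:1:] = (1 :: ('p, 'm) gray_ring)"
    by (metis hom_one one_pCons)
  ultimately show ?thesis
    by unfold_locales (simp_all add: gray_ring_const_def)
qed

text \<open>The representative \<open>a\<^sub>0 + a\<^sub>1 u + \<dots> + a\<^bsub>m-1\<^esub> u^(m-1)\<close> of an element of \<open>\<R>\<close> (for \<open>m \<ge> 2\<close>).\<close>

definition gray_ring_rep :: "('p::prime_card, 'm::finite) gray_ring \<Rightarrow> 'p mod_ring poly" where
  "gray_ring_rep r = rep_gray_ring r mod u_modulus TYPE('m)"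

lemma gray_ring_rep_of_poly:
  "gray_ring_rep (gray_ring_of_poly f :: ('p::prime_card, 'm::finite) gray_ring)
   = f mod u_modulus TYPE('m)"
proof -
  have "gray_ring_of_poly (rep_gray_ring (gray_ring_of_poly f :: ('p, 'm) gray_ring))
      = (gray_ring_of_poly f :: ('p, 'm) gray_ring)"
    unfolding gray_ring_of_poly_def by (rule Quotient_abs_rep[OF Quotient_gray_ring])
  then have "u_modulus TYPE('m) dvd rep_gray_ring (gray_ring_of_poly f :: ('p, 'm) gray_ring) - f"
    by (simp only: gray_ring_of_poly_eq_iff)
  then show ?thesis unfolding gray_ring_rep_def by (simp add: mod_eq_dvd_iff)
qed

text \<open>The idempotents \<open>\<eta>\<^sub>1, \<dots>, \<eta>\<^sub>m\<close>: the second branch is \<open>\<eta>\<^bsub>j+2\<^esub>\<close> with \<open>j = i - 2\<close>.\<close>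

definition eta :: "'p::prime_card mod_ring \<Rightarrow> nat \<Rightarrow> ('p, 'm::finite) gray_ring" where
  "eta \<xi> i = gray_ring_of_poly
     (if i = 1 then 1 - monom 1 (CARD('m) - 1)
      else smult (inverse (of_nat (CARD('m) - 1)))
             (\<Sum>k = 1..CARD('m) - 1. monom ((\<xi> ^ (i - 2)) ^ k) k))"

definition eta_set :: "'p::prime_card mod_ring \<Rightarrow> nat set \<Rightarrow> ('p, 'm::finite) gray_ring" where
  "eta_set \<xi> I = (\<Sum>i\<in>I. eta \<xi> i)"


section \<open>The rings \<open>A[x]/\<langle>x^n - 1\<rangle>\<close>, with \<open>n = CARD('n)\<close>\<close>

definition cyclic_modulus :: "'n::finite itself \<Rightarrow> 'a::comm_ring_1 poly" where
  "cyclic_modulus _ = monom 1 CARD('n) - 1"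

quotient_type (overloaded) ('a, 'n) cyclic_ring =
  "'a::comm_ring_1 poly" / "\<lambda>f g. cyclic_modulus TYPE('n::finite) dvd (f - g)"
proof (rule equivpI)
  show "reflp (\<lambda>f g. cyclic_modulus TYPE('n) dvd (f - g :: 'a poly))"
    by (simp add: reflp_def)
  show "symp (\<lambda>f g. cyclic_modulus TYPE('n) dvd (f - g :: 'a poly))"
    unfolding symp_def by (metis dvd_minus_iff minus_diff_eq)
  show "transp (\<lambda>f g. cyclic_modulus TYPE('n) dvd (f - g :: 'a poly))"
  proof (rule transpI)
    fix f g h :: "'a poly"
    assume "cyclic_modulus TYPE('n) dvd f - g" "cyclic_modulus TYPE('n) dvd g - h"
    then have "cyclic_modulus TYPE('n) dvd (f - g) + (g - h)" by (rule dvd_add)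
    then show "cyclic_modulus TYPE('n) dvd f - h" by simp
  qed
qed

lemma cyclic_modulus_not_dvd_1: "\<not> cyclic_modulus TYPE('n::finite) dvd (1 :: 'a::comm_ring_1 poly)"
proof
  assume *: "cyclic_modulus TYPE('n) dvd (1 :: 'a poly)"
  have "poly (cyclic_modulus TYPE('n)) (1 :: 'a) = 0"
    by (simp add: cyclic_modulus_def poly_monom)
  with * have "poly (1 :: 'a poly) 1 = 0" by (metis dvdE mult_zero_left poly_mult)
  then show False by simp
qed

instantiation cyclic_ring :: (comm_ring_1, finite) comm_ring_1
begin

lift_definition zero_cyclic_ring :: "('a, 'b) cyclic_ring" is 0 .
lift_definition one_cyclic_ring :: "('a, 'b) cyclic_ring" is 1 .
lift_definition plus_cyclic_ring :: "('a, 'b) cyclic_ring \<Rightarrow> ('a, 'b) cyclic_ring \<Rightarrow> ('a, 'b) cyclic_ring"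
  is "(+)" by (rule add_cong_dvd)
lift_definition minus_cyclic_ring :: "('a, 'b) cyclic_ring \<Rightarrow> ('a, 'b) cyclic_ring \<Rightarrow> ('a, 'b) cyclic_ring"
  is "(-)" by (rule add_cong_dvd)
lift_definition uminus_cyclic_ring :: "('a, 'b) cyclic_ring \<Rightarrow> ('a, 'b) cyclic_ring"
  is uminus by (rule uminus_cong_dvd)
lift_definition times_cyclic_ring :: "('a, 'b) cyclic_ring \<Rightarrow> ('a, 'b) cyclic_ring \<Rightarrow> ('a, 'b) cyclic_ring"
  is "(*)" by (rule mult_cong_dvd)

instance
proof
  fix a b c :: "('a, 'b) cyclic_ring"
  show "a * b * c = a * (b * c)" by transfer (simp add: mult.assoc)
  show "a * b = b * a" by transfer (simp add: mult.commute)
  show "1 * a = a" by transfer simp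
  show "a + b + c = a + (b + c)" by transfer (simp add: add.assoc)
  show "a + b = b + a" by transfer (simp add: add.commute)
  show "0 + a = a" by transfer simp
  show "- a + a = 0" by transfer simp
  show "a - b = a + - b" by transfer simp
  show "(a + b) * c = a * c + b * c" by transfer (simp add: distrib_right)
  show "(0 :: ('a, 'b) cyclic_ring) \<noteq> 1"
    by transfer (simp only: diff_0 dvd_minus_iff cyclic_modulus_not_dvd_1 not_False_eq_True)
qed

end

definition cyclic_ring_of_poly :: "'a::comm_ring_1 poly \<Rightarrow> ('a, 'n::finite) cyclic_ring" where
  "cyclic_ring_of_poly = abs_cyclic_ring"

lemma cyclic_ring_of_poly_hom:
  "comm_ring_hom (cyclic_ring_of_poly :: _ \<Rightarrow> ('a::comm_ring_1, 'n::finite) cyclic_ring)"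
  unfolding cyclic_ring_of_poly_def
  by standard (simp_all add: zero_cyclic_ring.abs_eq one_cyclic_ring.abs_eq
      plus_cyclic_ring.abs_eq times_cyclic_ring.abs_eq)

lemma cyclic_ring_of_poly_eq_iff:
  "cyclic_ring_of_poly f = (cyclic_ring_of_poly g :: ('a::comm_ring_1, 'n::finite) cyclic_ring)
   \<longleftrightarrow> cyclic_modulus TYPE('n) dvd (f - g)"
  unfolding cyclic_ring_of_poly_def by (simp add: cyclic_ring.abs_eq_iff)

text \<open>The inclusion of \<open>F\<^sub>p[x]/\<langle>x^q - 1\<rangle>\<close> into \<open>\<R>\<^sub>q = \<R>[x]/\<langle>x^q - 1\<rangle>\<close>.\<close>

definition cyclic_ring_incl ::
  "('p::prime_card mod_ring, 'n::finite) cyclic_ring \<Rightarrow> (('p, 'm::finite) gray_ring, 'n) cyclic_ring"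
  where "cyclic_ring_incl c = cyclic_ring_of_poly (map_poly gray_ring_const (rep_cyclic_ring c))"

lemma cyclic_ring_incl_of_poly:
  "cyclic_ring_incl (cyclic_ring_of_poly f :: ('p::prime_card mod_ring, 'n::finite) cyclic_ring)
   = (cyclic_ring_of_poly (map_poly gray_ring_const f) :: (('p, 'm::finite) gray_ring, 'n) cyclic_ring)"
proof -
  let ?c = "cyclic_ring_of_poly f :: ('p mod_ring, 'n) cyclic_ring"
  interpret comm_ring_hom "gray_ring_const :: _ \<Rightarrow> ('p, 'm) gray_ring"
    by (rule gray_ring_const_hom)
  interpret P: map_poly_comm_ring_hom "gray_ring_const :: _ \<Rightarrow> ('p, 'm) gray_ring" ..
  have mod_eq: "map_poly gray_ring_const (cyclic_modulus TYPE('n) :: 'p mod_ring poly)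
      = (cyclic_modulus TYPE('n) :: ('p, 'm) gray_ring poly)"
    by (simp add: cyclic_modulus_def hom_distribs)
  have "cyclic_ring_of_poly (rep_cyclic_ring ?c) = ?c"
    unfolding cyclic_ring_of_poly_def by (rule Quotient_abs_rep[OF Quotient_cyclic_ring])
  then have "cyclic_modulus TYPE('n) dvd rep_cyclic_ring ?c - f"
    by (simp only: cyclic_ring_of_poly_eq_iff)
  then have "map_poly gray_ring_const (cyclic_modulus TYPE('n))
      dvd (map_poly gray_ring_const (rep_cyclic_ring ?c - f) :: ('p, 'm) gray_ring poly)"
    by (rule P.hom_dvd)
  then show ?thesis
    by (simp only: cyclic_ring_incl_def cyclic_ring_of_poly_eq_iff mod_eq P.hom_minus)
qed

definition principal_ideal :: "'a::comm_ring_1 \<Rightarrow> 'a set" where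
  "principal_ideal a = {x. a dvd x}"

definition idempotent_generator :: "'a::comm_ring_1 \<Rightarrow> 'a set \<Rightarrow> bool" where
  "idempotent_generator d J \<longleftrightarrow> d * d = d \<and> principal_ideal d = J"

text \<open>A set of elements of \<open>A[x]/\<langle>x^n - 1\<rangle>\<close> as a set of coefficient vectors
  \<open>(c\<^sub>0, \<dots>, c\<^bsub>n-1\<^esub>)\<close>.\<close>

definition coeff_vectors :: "('a::comm_ring_1, 'n::finite) cyclic_ring set \<Rightarrow> 'a vec set" where
  "coeff_vectors J =
     {c \<in> carrier_vec CARD('n). cyclic_ring_of_poly (\<Sum>i<CARD('n). monom (c $ i) i) \<in> J}"


section \<open>Linear codes\<close>

definition linear_code :: "nat \<Rightarrow> 'a::comm_ring_1 vec set \<Rightarrow> bool" where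
  "linear_code n C \<longleftrightarrow> LinearCombinations.submodule class_ring C (module_vec TYPE('a) n)"

definition code_span :: "nat \<Rightarrow> 'a::comm_ring_1 vec set \<Rightarrow> 'a vec set" where
  "code_span n G = LinearCombinations.module.span class_ring (module_vec TYPE('a) n) G"

definition dual_code :: "nat \<Rightarrow> 'a::comm_ring_1 vec set \<Rightarrow> 'a vec set" where
  "dual_code n C = {v \<in> carrier_vec n. \<forall>c\<in>C. v \<bullet> c = 0}"

definition self_dual :: "nat \<Rightarrow> 'a::comm_ring_1 vec set \<Rightarrow> bool" where
  "self_dual n C \<longleftrightarrow> linear_code n C \<and> C = dual_code n C"

definition self_orthogonal :: "nat \<Rightarrow> 'a::comm_ring_1 vec set \<Rightarrow> bool" where
  "self_orthogonal n C \<longleftrightarrow> linear_code n C \<and> C \<subseteq> dual_code n C"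

definition hamming_weight :: "'a::zero vec \<Rightarrow> nat" where
  "hamming_weight v = card {i. i < dim_vec v \<and> v $ i \<noteq> 0}"

text \<open>The homogeneous weight enumerator \<open>\<Sum>c\<in>C. X^(n - wt c) Y^(wt c)\<close>, as a polynomial in \<open>Y\<close>
  over \<open>\<int>[X]\<close>.\<close>

definition weight_enumerator :: "nat \<Rightarrow> 'a::zero vec set \<Rightarrow> int poly poly" where
  "weight_enumerator n C = (\<Sum>c\<in>C. monom (monom 1 (n - hamming_weight c)) (hamming_weight c))"

definition formally_self_dual :: "nat \<Rightarrow> 'a::comm_ring_1 vec set \<Rightarrow> bool" where
  "formally_self_dual n C \<longleftrightarrow>
     linear_code n C \<and> weight_enumerator n C = weight_enumerator n (dual_code n C)"


section \<open>The Gray map\<close>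

definition gray_eval :: "'p::prime_card mod_ring \<Rightarrow> ('p, 'm::finite) gray_ring \<Rightarrow> 'p mod_ring vec" where
  "gray_eval \<xi> r =
     vec CARD('m) (\<lambda>i. poly (gray_ring_rep r) (if i = 0 then 0 else \<xi> ^ (i - 1)))"

text \<open>The \<open>j\<close>-th entry of the row vector \<open>w V\<close> is the product of \<open>w\<close> with the \<open>j\<close>-th column of \<open>V\<close>.\<close>

definition gray_map ::
  "'p::prime_card mod_ring mat \<Rightarrow> 'p mod_ring \<Rightarrow> ('p, 'm::finite) gray_ring \<Rightarrow> 'p mod_ring vec" where
  "gray_map V \<xi> r = vec CARD('m) (\<lambda>j. gray_eval \<xi> r \<bullet> col V j)"

definition gray_map_vec ::
  "'p::prime_card mod_ring mat \<Rightarrow> 'p mod_ring \<Rightarrow> ('p, 'm::finite) gray_ring vec \<Rightarrow> 'p mod_ring vec" where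
  "gray_map_vec V \<xi> x =
     vec (CARD('m) * dim_vec x)
       (\<lambda>i. gray_map V \<xi> (x $ (i div CARD('m))) $ (i mod CARD('m)))"


section \<open>Quadratic residue codes\<close>

definition primitive_element :: "'a::field \<Rightarrow> bool" where
  "primitive_element \<alpha> \<longleftrightarrow> range (\<lambda>k::nat. \<alpha> ^ k) = {x. x \<noteq> 0}"

definition primitive_root_of_unity :: "nat \<Rightarrow> 'k::field \<Rightarrow> bool" where
  "primitive_root_of_unity n \<zeta> \<longleftrightarrow> \<zeta> ^ n = 1 \<and> (\<forall>k. 0 < k \<and> k < n \<longrightarrow> \<zeta> ^ k \<noteq> 1)"

definition quad_residues :: "nat \<Rightarrow> nat set" where
  "quad_residues q = {i \<in> {1..<q}. QuadRes (int q) (int i)}"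

definition quad_nonresidues :: "nat \<Rightarrow> nat set" where
  "quad_nonresidues q = {i \<in> {1..<q}. \<not> QuadRes (int q) (int i)}"

text \<open>\<open>\<eta> a + (1 - \<eta>) b\<close> in \<open>\<R>\<^sub>q\<close>, for \<open>\<eta>\<close> in \<open>\<R>\<close> and \<open>a, b\<close> in \<open>F\<^sub>p[x]/\<langle>x^q - 1\<rangle>\<close>; with
  \<open>\<eta> = \<eta>\<^sub>I\<close> this gives \<open>D\<^sub>I\<close> from \<open>d\<^sub>1, d\<^sub>2\<close> and \<open>E\<^sub>I\<close> from \<open>e\<^sub>1, e\<^sub>2\<close>.\<close>

definition idempotent_mix ::
  "('p::prime_card, 'm::finite) gray_ring \<Rightarrow> ('p mod_ring, 'n::finite) cyclic_ring
   \<Rightarrow> ('p mod_ring, 'n) cyclic_ring \<Rightarrow> (('p, 'm) gray_ring, 'n) cyclic_ring" where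
  "idempotent_mix \<eta> a b =
     cyclic_ring_of_poly [:\<eta>:] * cyclic_ring_incl a
     + cyclic_ring_of_poly [:1 - \<eta>:] * cyclic_ring_incl b"

text \<open>The code \<open>Q\<^sub>I\<close> (from \<open>d\<^sub>1, d\<^sub>2\<close>) or \<open>S\<^sub>I\<close> (from \<open>e\<^sub>1, e\<^sub>2\<close>).\<close>

definition qr_code ::
  "'p::prime_card mod_ring \<Rightarrow> nat set \<Rightarrow> ('p mod_ring, 'n::finite) cyclic_ring
   \<Rightarrow> ('p mod_ring, 'n) cyclic_ring \<Rightarrow> ('p, 'm::finite) gray_ring vec set" where
  "qr_code \<xi> I a b = coeff_vectors (principal_ideal (idempotent_mix (eta_set \<xi> I) a b))"

text \<open>The extended code: coordinate \<open>\<infinity>\<close> is coordinate \<open>0\<close> of the vectors of length \<open>q + 1\<close>.\<close>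

definition extended_code ::
  "nat \<Rightarrow> 'p::prime_card mod_ring \<Rightarrow> ('p, 'm::finite) gray_ring vec set \<Rightarrow> ('p, 'm) gray_ring vec set" where
  "extended_code q r S =
     code_span (q + 1) (vCons 0 ` S \<union> {vCons (gray_ring_const r) (vec q (\<lambda>_. 1))})"

end

theory Submission
  imports Defs
begin

text \<open>
  The reason for the theorem is that everything can be seen after two transforms.

  First, evaluation of a representative at the \<open>m\<close> roots \<open>0, 1, \<xi>, \<dots>, \<xi>^(m-2)\<close> of \<open>u^m - u\<close>
  is a ring isomorphism from \<open>\<R>\<close> to \<open>F\<^sub>p^m\<close> (\<open>ev_injective\<close>, \<open>ev_surjective\<close>). It sends
  \<open>\<eta>\<^sub>I\<close> to a vector with entries \<open>0\<close> and \<open>1\<close>. Hence \<open>S\<^sub>I\<close> is the code whose component at an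
  evaluation point is the even-like residue code if \<open>\<eta>\<^sub>I\<close> takes the value \<open>1\<close> there, and the
  even-like non-residue code otherwise (\<open>qr_code_components\<close>), and the extended code splits in the
  same way (\<open>extended_code_components\<close>). As \<open>V V\<^sup>T = \<lambda> I\<close>, the Gray map is a bijection which
  multiplies the sum of the inner products of the components by \<open>\<lambda>\<close> (\<open>gray_scalar_prod\<close>), so
  that the dual of a Gray image is the Gray image of the componentwise dual
  (\<open>dual_gray_code\<close>).

  Second, the codes over \<open>F\<^sub>p\<close> are described by the vanishing of Fourier coefficients at the powers
  of \<open>\<zeta>\<close>, and the extended ones by one more linear equation that ties the coordinate at infinity
  to the sum of the other coordinates. By Parseval's identity the dual of an extended code with
  zeros \<open>Z\<close> is a code of the same kind with zeros the nonzero \<open>j\<close> such that \<open>-j \<notin> Z\<close> (\<open>dual_ext_code\<close>).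
  If \<open>q \<equiv> 3 (mod 4)\<close> then \<open>-1\<close> is a non-residue and this set is \<open>Z\<close> itself; the equations at
  infinity agree because \<open>r\<^sup>2 = -q\<close>. If \<open>q \<equiv> 1 (mod 4)\<close> then \<open>-1\<close> is a residue and the dual has
  residues and non-residues interchanged; multiplying the positions of the cyclic coordinates by
  a fixed non-residue and the coordinate at infinity by \<open>-q\<close> carries the code onto its dual. This
  transformation is the same in all components and its factors lie in \<open>F\<^sub>p\<close>, so that it preserves
  the weights of Gray images although the Gray map mixes the components
  (\<open>weight_enumerator_monomial\<close>).
\<close>

section \<open>The discrete Fourier transform\<close>

lemma prod_linear_dvd:
  fixes f :: "'a::field poly"
  assumes "finite A" "inj_on c A" "\<And>a. a \<in> A \<Longrightarrow> poly f (c a) = 0"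
  shows "(\<Prod>a\<in>A. [:- c a, 1:]) dvd f"
  using assms
proof (induction A rule: finite_induct)
  case (insert b A)
  have "(\<Prod>a\<in>A. [:- c a, 1:]) dvd f"
    by (rule insert.IH) (use insert.prems in \<open>auto simp: inj_on_insert\<close>)
  then obtain k where k: "f = (\<Prod>a\<in>A. [:- c a, 1:]) * k" by (rule dvdE)
  have "poly (\<Prod>a\<in>A. [:- c a, 1:]) (c b) \<noteq> 0"
    using insert.hyps insert.prems(1) by (force simp: poly_prod)
  then have "poly k (c b) = 0" using insert.prems(2)[of b] unfolding k poly_mult by simp
  then have "[:- c b, 1:] dvd k" by (simp only: poly_eq_0_iff_dvd)
  then have "(\<Prod>a\<in>A. [:- c a, 1:]) * [:- c b, 1:] dvd f"
    unfolding k by (rule mult_dvd_mono[OF dvd_refl])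
  then show ?case using insert.hyps by (simp add: mult.commute)
qed simp

text \<open>A primitive root of unity whose order is invertible in the field.\<close>

locale root_of_unity =
  fixes \<zeta> :: "'k::field" and q :: nat
  assumes prim: "primitive_root_of_unity q \<zeta>"
    and q_pos: "0 < q"
    and q_unit: "of_nat q \<noteq> (0 :: 'k)"
begin

lemma power_q: "\<zeta> ^ q = 1"
  using prim by (simp add: primitive_root_of_unity_def)

lemma power_cong:
  assumes "a mod q = b mod q"
  shows "\<zeta> ^ a = \<zeta> ^ b"
proof -
  have "\<zeta> ^ n = \<zeta> ^ (n mod q)" for n
  proof -
    have "\<zeta> ^ n = \<zeta> ^ (q * (n div q) + n mod q)" by simp
    also have "\<dots> = \<zeta> ^ (n mod q)" unfolding power_add power_mult power_q by simp
    finally show ?thesis .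
  qed
  then show ?thesis using assms by metis
qed

lemma power_eq_1_iff: "\<zeta> ^ n = 1 \<longleftrightarrow> q dvd n"
proof
  assume "\<zeta> ^ n = 1"
  then have "\<zeta> ^ (n mod q) = 1" using power_cong[of n "n mod q"] by simp
  then show "q dvd n"
    using prim q_pos unfolding primitive_root_of_unity_def
    by (metis mod_greater_zero_iff_not_dvd mod_less_divisor)
next
  assume "q dvd n"
  then show "\<zeta> ^ n = 1" by (auto simp: power_mult power_q elim: dvdE)
qed

lemma zeta_nonzero: "\<zeta> \<noteq> 0"
  using power_q q_pos by (auto simp: power_0_left)

lemma inj_on_power: "inj_on (\<lambda>i. \<zeta> ^ i) {..<q}"
proof (rule linorder_inj_onI')
  fix a b assume ab: "a \<in> {..<q}" "b \<in> {..<q}" "a < b"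
  have "\<zeta> ^ b = \<zeta> ^ a * \<zeta> ^ (b - a)"
    unfolding power_add[symmetric] using ab by simp
  moreover have "\<zeta> ^ (b - a) \<noteq> 1"
    unfolding power_eq_1_iff using ab by (auto dest: dvd_imp_le)
  ultimately show "\<zeta> ^ a \<noteq> \<zeta> ^ b"
    using zeta_nonzero by auto
qed

text \<open>The Fourier coefficient of index \<open>i\<close>; only the values \<open>x 0, \<dots>, x (q - 1)\<close> matter, and \<open>i\<close> matters
  modulo \<open>q\<close>.\<close>

definition dft :: "(nat \<Rightarrow> 'k) \<Rightarrow> nat \<Rightarrow> 'k" where
  "dft x i = (\<Sum>t<q. x t * \<zeta> ^ (i * t))"

lemma dft_cong: "(\<And>t. t < q \<Longrightarrow> x t = y t) \<Longrightarrow> dft x i = dft y i"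
  unfolding dft_def by (rule sum.cong) auto

lemma dft_add: "dft (\<lambda>t. x t + y t) i = dft x i + dft y i"
  by (simp add: dft_def sum.distrib algebra_simps)

lemma dft_scale: "dft (\<lambda>t. c * x t) i = c * dft x i"
  by (simp add: dft_def sum_distrib_left algebra_simps)

lemma dft_0: "dft x 0 = (\<Sum>t<q. x t)"
  by (simp add: dft_def)

lemma dft_index_cong: "i mod q = j mod q \<Longrightarrow> dft x i = dft x j"
  unfolding dft_def by (intro sum.cong refl arg_cong2[of _ _ _ _ "(*)"] power_cong)
    (metis mod_mult_left_eq)

lemma orthogonality:
  assumes "a < q" "b < q"
  shows "(\<Sum>i<q. \<zeta> ^ (i * a) * \<zeta> ^ ((q - i) * b)) = (if a = b then of_nat q else 0)"
proof -
  define w where "w = \<zeta> ^ (a + (q - 1) * b)"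
  have term_eq: "\<zeta> ^ (i * a) * \<zeta> ^ ((q - i) * b) = w ^ i" if "i < q" for i
  proof -
    have "(q - i) * b + i * b = q * b" using that by (simp flip: distrib_right)
    moreover have "(q - 1) * b * i + i * b = q * (i * b)"
      using q_pos by (cases q) (simp_all add: algebra_simps)
    ultimately have "[(q - i) * b + i * b = (q - 1) * b * i + i * b] (mod q)"
      by (simp add: cong_def)
    then have "[(q - i) * b = (q - 1) * b * i] (mod q)"
      by (simp add: cong_add_rcancel_nat)
    then have "\<zeta> ^ ((q - i) * b) = \<zeta> ^ ((q - 1) * b * i)"
      by (intro power_cong) (simp add: cong_def)
    then show ?thesis
      by (simp only: w_def power_add power_mult_distrib power_mult[symmetric] mult.commute[of i a])
  qed
  have "(\<Sum>i<q. \<zeta> ^ (i * a) * \<zeta> ^ ((q - i) * b)) = (\<Sum>i<q. w ^ i)"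
    by (rule sum.cong) (auto simp: term_eq)
  also have "\<dots> = (if a = b then of_nat q else 0)"
  proof (cases "a = b")
    case True
    have "a + (q - 1) * a = q * a" using q_pos by (cases q) simp_all
    then have "w = 1" using True by (simp add: w_def power_mult power_q)
    then show ?thesis using True by simp
  next
    case False
    have "w \<noteq> 1"
    proof
      assume "w = 1"
      then have "q dvd a + (q - 1) * b" by (simp add: w_def power_eq_1_iff)
      then have "[a + (q - 1) * b + b = 0 + b] (mod q)"
        by (intro cong_add) (simp_all add: cong_0_iff)
      moreover have "(q - 1) * b + b = q * b" using q_pos by (cases q) simp_all
      ultimately have "[a = b] (mod q)" by (simp add: cong_def add.assoc)
      then show False using assms False by (simp add: cong_def)
    qed
    moreover have "(w - 1) * (\<Sum>i<q. w ^ i) = 0"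
    proof -
      have "w ^ q = 1" by (simp add: w_def power_eq_1_iff flip: power_mult)
      then show ?thesis by (simp add: power_diff_1_eq[symmetric])
    qed
    ultimately show ?thesis using False by simp
  qed
  finally show ?thesis .
qed

text \<open>Indices are taken modulo \<open>q\<close>, so that \<open>q - i\<close> stands for \<open>-i\<close>.\<close>

lemma parseval: "(\<Sum>i<q. dft x i * dft y (q - i)) = of_nat q * (\<Sum>t<q. x t * y t)"
proof -
  have "(\<Sum>i<q. dft x i * dft y (q - i))
      = (\<Sum>i<q. \<Sum>a<q. \<Sum>b<q. x a * y b * (\<zeta> ^ (i * a) * \<zeta> ^ ((q - i) * b)))"
    by (simp add: dft_def sum_product algebra_simps)
  also have "\<dots> = (\<Sum>a<q. \<Sum>i<q. \<Sum>b<q. x a * y b * (\<zeta> ^ (i * a) * \<zeta> ^ ((q - i) * b)))"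
    by (rule sum.swap)
  also have "\<dots> = (\<Sum>a<q. \<Sum>b<q. \<Sum>i<q. x a * y b * (\<zeta> ^ (i * a) * \<zeta> ^ ((q - i) * b)))"
    by (intro sum.cong refl sum.swap)
  also have "\<dots> = (\<Sum>a<q. \<Sum>b<q. x a * y b * (if a = b then of_nat q else 0))"
    by (intro sum.cong refl) (simp only: sum_distrib_left[symmetric] orthogonality lessThan_iff)
  also have "\<dots> = (\<Sum>a<q. x a * y a * of_nat q)"
    by (intro sum.cong refl) (simp add: if_distrib[of "\<lambda>u. _ * u"] sum.delta cong: if_cong)
  also have "\<dots> = of_nat q * (\<Sum>t<q. x t * y t)"
    by (simp add: sum_distrib_left algebra_simps)
  finally show ?thesis .
qed

lemma dft_injective:
  assumes "\<And>i. i < q \<Longrightarrow> dft x i = 0" "t < q"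
  shows "x t = 0"
proof -
  have "of_nat q * (\<Sum>s<q. x s * (if s = t then 1 else 0)) = 0"
    unfolding parseval[symmetric] using assms(1) by simp
  then show ?thesis
    using q_unit assms(2) by (simp add: if_distrib[of "\<lambda>u. _ * u"] sum.delta cong: if_cong)
qed

lemma dft_const:
  assumes "0 < i" "i < q"
  shows "dft (\<lambda>_. c) i = 0"
proof -
  have "dft (\<lambda>_. c) i = c * (\<Sum>t<q. (\<zeta> ^ i) ^ t)"
    by (simp add: dft_def sum_distrib_left flip: power_mult)
  moreover have "\<zeta> ^ i \<noteq> 1" using assms by (auto simp: power_eq_1_iff dest: dvd_imp_le)
  moreover have "(\<zeta> ^ i - 1) * (\<Sum>t<q. (\<zeta> ^ i) ^ t) = 0"
  proof -
    have "(\<zeta> ^ i) ^ q = 1" by (simp add: power_eq_1_iff flip: power_mult)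
    then show ?thesis by (simp add: power_diff_1_eq[symmetric])
  qed
  ultimately show ?thesis by simp
qed

text \<open>Multiplying the time index by a unit \<open>c\<close> modulo \<open>q\<close> permutes the
  frequencies.\<close>

lemma dft_permute:
  assumes "coprime c q"
  shows "dft (\<lambda>t. x (c * t mod q)) (c * i) = dft x i"
proof -
  have inj: "inj_on (\<lambda>t. c * t mod q) {..<q}"
  proof (rule inj_onI)
    fix a b assume "a \<in> {..<q}" "b \<in> {..<q}" "c * a mod q = c * b mod q"
    then have "[a = b] (mod q)"
      using cong_mult_lcancel_nat[OF assms] by (simp add: cong_def)
    then show "a = b" using \<open>a \<in> _\<close> \<open>b \<in> _\<close> by (simp add: cong_def)
  qed
  have "bij_betw (\<lambda>t. c * t mod q) {..<q} {..<q}"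
    by (intro bij_betw_imageI endo_inj_surj inj) (use q_pos in auto)
  then have "dft x i = (\<Sum>t<q. x (c * t mod q) * \<zeta> ^ (i * (c * t mod q)))"
    unfolding dft_def by (rule sum.reindex_bij_betw[symmetric])
  also have "\<dots> = dft (\<lambda>t. x (c * t mod q)) (c * i)"
    unfolding dft_def by (intro sum.cong refl arg_cong2[of _ _ _ _ "(*)"] power_cong)
      (simp add: mod_mult_right_eq ac_simps)
  finally show ?thesis by simp
qed

end

section \<open>Cyclic codes given by their zeros\<close>

text \<open>A field \<open>'f\<close> embedded in a field that contains a primitive \<open>q\<close>-th root of
  unity.\<close>

locale cyclic_zeros = root_of_unity \<zeta> q + field_hom emb
  for emb :: "'f::field \<Rightarrow> 'k::field" and \<zeta> :: 'k and q :: nat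
begin

interpretation P: map_poly_comm_ring_hom emb ..

lemma q_unit_base: "of_nat q \<noteq> (0 :: 'f)"
proof
  assume "of_nat q = (0 :: 'f)"
  then have "emb (of_nat q) = 0" by simp
  then show False using q_unit by (simp add: hom_of_nat)
qed

text \<open>The Fourier transform of a word is its evaluation at the powers of \<open>\<zeta>\<close>.\<close>

definition spectrum :: "(nat \<Rightarrow> 'f) \<Rightarrow> nat \<Rightarrow> 'k" where
  "spectrum x = dft (\<lambda>t. emb (x t))"

lemma spectrum_cong: "(\<And>t. t < q \<Longrightarrow> x t = y t) \<Longrightarrow> spectrum x i = spectrum y i"
  unfolding spectrum_def by (rule dft_cong) simp

lemma spectrum_add: "spectrum (\<lambda>t. x t + y t) i = spectrum x i + spectrum y i"
  by (simp add: spectrum_def hom_add dft_add)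

lemma spectrum_scale: "spectrum (\<lambda>t. c * x t) i = emb c * spectrum x i"
  by (simp add: spectrum_def hom_mult dft_scale)

lemma spectrum_zero [simp]: "spectrum (\<lambda>_. 0) i = 0"
  by (simp add: spectrum_def dft_def)

lemma spectrum_0: "spectrum x 0 = emb (\<Sum>t<q. x t)"
  by (simp add: spectrum_def dft_0 hom_sum)

lemma spectrum_0_eq_0_iff: "spectrum x 0 = 0 \<longleftrightarrow> (\<Sum>t<q. x t) = 0"
  by (simp add: spectrum_0)

lemma spectrum_const: "0 < i \<Longrightarrow> i < q \<Longrightarrow> spectrum (\<lambda>_. c) i = 0"
  by (simp add: spectrum_def dft_const)

lemma spectrum_parseval:
  "(\<Sum>i<q. spectrum x i * spectrum y (q - i)) = of_nat q * emb (\<Sum>t<q. x t * y t)"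
  unfolding spectrum_def parseval by (simp add: hom_sum hom_mult)

text \<open>The coefficient vector of a polynomial of any degree reduced modulo \<open>x^q - 1\<close>.\<close>

definition wrap_coeff :: "'f poly \<Rightarrow> nat \<Rightarrow> 'f" where
  "wrap_coeff f t = (\<Sum>k | k \<le> degree f \<and> k mod q = t. coeff f k)"

lemma spectrum_wrap_coeff: "spectrum (wrap_coeff f) i = poly (map_poly emb f) (\<zeta> ^ i)"
proof -
  have "poly (map_poly emb f) (\<zeta> ^ i) = (\<Sum>k\<le>degree f. emb (coeff f k) * \<zeta> ^ (i * k))"
    by (simp add: poly_altdef power_mult)
  also have "\<dots> = (\<Sum>t<q. \<Sum>k | k \<in> {..degree f} \<and> k mod q = t. emb (coeff f k) * \<zeta> ^ (i * k))"
    by (rule sum.group[symmetric]) (use q_pos in auto)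
  also have "\<dots> = (\<Sum>t<q. \<Sum>k | k \<in> {..degree f} \<and> k mod q = t. emb (coeff f k) * \<zeta> ^ (i * t))"
    by (intro sum.cong refl arg_cong2[of _ _ _ _ "(*)"] power_cong)
      (auto simp: mod_mult_right_eq)
  also have "\<dots> = spectrum (wrap_coeff f) i"
    by (simp add: spectrum_def dft_def wrap_coeff_def hom_sum sum_distrib_right)
  finally show ?thesis by simp
qed

lemma spectrum_poly:
  "poly (map_poly emb (\<Sum>t<q. monom (x t) t)) (\<zeta> ^ i) = spectrum x i"
  by (simp add: P.hom_sum poly_sum poly_monom spectrum_def dft_def flip: power_mult)

text \<open>\<open>zeros_poly Z g\<close> says that \<open>g\<close> is the generator polynomial, over the small
  field, of the even-like cyclic code with zeros \<open>\<zeta>^i\<close> for \<open>i\<close> in \<open>Z\<close>.\<close>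

definition zeros_poly :: "nat set \<Rightarrow> 'f poly \<Rightarrow> bool" where
  "zeros_poly Z g \<longleftrightarrow> Z \<subseteq> {1..<q} \<and>
     map_poly emb g = (\<Prod>i\<in>insert 0 Z. [:- (\<zeta> ^ i), 1:])"

lemma zeros_poly_mult:
  assumes Z: "Z \<subseteq> {1..<q}" and z: "map_poly emb z = (\<Prod>i\<in>Z. [:- (\<zeta> ^ i), 1:])"
  shows "zeros_poly Z ([:-1, 1:] * z)"
proof -
  have "finite Z" "0 \<notin> Z" using Z by (auto intro: finite_subset)
  moreover have "map_poly emb [:-1, 1:] = [:- (\<zeta> ^ 0), 1:]"
    by (simp add: hom_uminus)
  ultimately have "map_poly emb ([:-1, 1:] * z) = (\<Prod>i\<in>insert 0 Z. [:- (\<zeta> ^ i), 1:])"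
    by (simp only: P.hom_mult z prod.insert not_False_eq_True)
  then show ?thesis using Z by (simp add: zeros_poly_def)
qed

lemma zeros_poly_eval:
  assumes "zeros_poly Z g" "i < q"
  shows "poly (map_poly emb g) (\<zeta> ^ i) = 0 \<longleftrightarrow> i = 0 \<or> i \<in> Z"
proof -
  have fin: "finite (insert 0 Z)" and sub: "insert 0 Z \<subseteq> {..<q}"
    using assms(1) q_pos by (auto simp: zeros_poly_def intro: finite_subset)
  have "poly (map_poly emb g) (\<zeta> ^ i) = (\<Prod>j\<in>insert 0 Z. \<zeta> ^ i - \<zeta> ^ j)"
    using assms(1) by (simp add: zeros_poly_def poly_prod)
  then have "poly (map_poly emb g) (\<zeta> ^ i) = 0 \<longleftrightarrow> (\<exists>j\<in>insert 0 Z. \<zeta> ^ i = \<zeta> ^ j)"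
    using fin by (simp only: prod_zero_iff right_minus_eq) 
  also have "\<dots> \<longleftrightarrow> i \<in> insert 0 Z"
    using inj_on_eq_iff[OF inj_on_power] assms(2) sub by blast
  finally show ?thesis by simp
qed

text \<open>A word lies in the ideal generated by the generator polynomial if and only if it
  vanishes at the zeros.\<close>

lemma generated_iff_zeros:
  assumes g: "zeros_poly Z g" and q: "CARD('n::finite) = q"
  shows "cyclic_ring_of_poly (\<Sum>t<q. monom (x t) t)
           \<in> principal_ideal (cyclic_ring_of_poly g :: ('f, 'n) cyclic_ring)
         \<longleftrightarrow> spectrum x 0 = 0 \<and> (\<forall>i\<in>Z. spectrum x i = 0)"
    (is "cyclic_ring_of_poly ?f \<in> _ \<longleftrightarrow> _")
proof -
  interpret C: comm_ring_hom "cyclic_ring_of_poly :: 'f poly \<Rightarrow> ('f, 'n) cyclic_ring"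
    by (rule cyclic_ring_of_poly_hom)
  have Z: "insert 0 Z \<subseteq> {..<q}" "finite (insert 0 Z)"
    using g q_pos by (auto simp: zeros_poly_def intro: finite_subset)
  show ?thesis
  proof
    assume "cyclic_ring_of_poly ?f \<in> principal_ideal (cyclic_ring_of_poly g :: ('f, 'n) cyclic_ring)"
    then obtain h :: "('f, 'n) cyclic_ring" where h: "cyclic_ring_of_poly ?f = cyclic_ring_of_poly g * h"
      by (auto simp: principal_ideal_def dvd_def)
    obtain h' where h': "h = cyclic_ring_of_poly h'"
      unfolding cyclic_ring_of_poly_def by (metis Quotient_abs_rep Quotient_cyclic_ring)
    have "cyclic_ring_of_poly ?f = (cyclic_ring_of_poly (g * h') :: ('f, 'n) cyclic_ring)"
      by (simp add: h h' C.hom_mult)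
    then obtain k where k: "?f - g * h' = cyclic_modulus TYPE('n) * k"
      unfolding cyclic_ring_of_poly_eq_iff dvd_def by blast
    have "spectrum x i = 0" if i: "i \<in> insert 0 Z" for i
    proof -
      have "?f = g * h' + cyclic_modulus TYPE('n) * k" using k by (simp add: algebra_simps)
      then have "spectrum x i = poly (map_poly emb (g * h' + cyclic_modulus TYPE('n) * k)) (\<zeta> ^ i)"
        by (metis spectrum_poly)
      moreover have "poly (map_poly emb g) (\<zeta> ^ i) = 0"
        using zeros_poly_eval[OF g] i Z by blast
      moreover have "poly (map_poly emb (cyclic_modulus TYPE('n))) (\<zeta> ^ i) = 0"
        by (simp add: cyclic_modulus_def q P.hom_minus poly_monom power_eq_1_iff flip: power_mult)
      ultimately show ?thesis by (simp add: P.hom_add P.hom_mult)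
    qed
    then show "spectrum x 0 = 0 \<and> (\<forall>i\<in>Z. spectrum x i = 0)" by simp
  next
    assume zeros: "spectrum x 0 = 0 \<and> (\<forall>i\<in>Z. spectrum x i = 0)"
    have "(\<Prod>i\<in>insert 0 Z. [:- (\<zeta> ^ i), 1:]) dvd map_poly emb ?f"
    proof (rule prod_linear_dvd[OF Z(2)])
      show "inj_on (\<lambda>i. \<zeta> ^ i) (insert 0 Z)"
        using inj_on_power Z(1) by (rule inj_on_subset)
    qed (use zeros in \<open>auto simp only: spectrum_poly\<close>)
    then have "g dvd ?f"
      using g by (intro dvd_map_poly_hom_imp_dvd) (simp add: zeros_poly_def)
    then show "cyclic_ring_of_poly ?f \<in> principal_ideal (cyclic_ring_of_poly g :: ('f, 'n) cyclic_ring)"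
      by (simp add: principal_ideal_def C.hom_dvd)
  qed
qed

text \<open>The even-like cyclic code with zeros \<open>\<zeta>^i\<close> for \<open>i = 0\<close> and \<open>i\<close> in \<open>Z\<close>.\<close>

definition even_code :: "nat set \<Rightarrow> 'f vec set" where
  "even_code Z = {x \<in> carrier_vec q. \<forall>i\<in>insert 0 Z. spectrum (($) x) i = 0}"

text \<open>Words \<open>(x\<^sub>\<infinity>, x\<^sub>0, \<dots>, x\<^bsub>q-1\<^esub>)\<close> whose cyclic part has the zeros \<open>Z\<close> and satisfies
  \<open>a (x\<^sub>0 + \<dots> + x\<^bsub>q-1\<^esub>) = b x\<^sub>\<infinity>\<close>. The extension of the even-like code by \<open>(r, 1, \<dots>, 1)\<close> is the
  case \<open>a = r\<close>, \<open>b = q\<close>; the second parameter allows for the dual codes as well.\<close>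

definition ext_code :: "nat set \<Rightarrow> 'f \<Rightarrow> 'f \<Rightarrow> 'f vec set" where
  "ext_code Z a b = {x \<in> carrier_vec (Suc q).
     a * (\<Sum>t<q. x $ Suc t) = b * x $ 0 \<and> (\<forall>i\<in>Z. spectrum (\<lambda>t. x $ Suc t) i = 0)}"

lemma ext_code_scale: "c \<noteq> 0 \<Longrightarrow> ext_code Z (c * a) (c * b) = ext_code Z a b"
  by (auto simp: ext_code_def mult.assoc)

lemma scalar_prod_Suc:
  assumes "y \<in> carrier_vec (Suc q)" "x \<in> carrier_vec (Suc q)"
  shows "(y :: 'f vec) \<bullet> x = y $ 0 * x $ 0 + (\<Sum>t<q. y $ Suc t * x $ Suc t)"
  using assms by (simp add: scalar_prod_def atLeast0LessThan sum.lessThan_Suc_shift del: sum.lessThan_Suc)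

text \<open>The extension of an even-like code that has a generator polynomial is dual to a code of the
  same kind. Parseval's identity gives one inclusion. For the other, orthogonality to all cyclic
  shifts of the generator polynomial forces the complementary zeros.\<close>

lemma dual_ext_code:
  assumes g: "zeros_poly Z g"
  shows "dual_code (Suc q) (ext_code Z r (of_nat q)) = ext_code {i \<in> {1..<q}. q - i \<notin> Z} 1 (- r)"
proof (intro equalityI subsetI)
  fix y assume y: "y \<in> dual_code (Suc q) (ext_code Z r (of_nat q))"
  then have dim: "y \<in> carrier_vec (Suc q)" by (simp add: dual_code_def)
  have orth: "y \<bullet> x = 0" if "x \<in> ext_code Z r (of_nat q)" for x
    using y that by (simp add: dual_code_def)
  have "vec (Suc q) (\<lambda>t. if t = 0 then r else 1) \<in> ext_code Z r (of_nat q)"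
    using g by (auto simp: ext_code_def zeros_poly_def mult.commute subset_eq
        cong: spectrum_cong intro!: trans[OF spectrum_cong spectrum_const])
  from orth[OF this] have sum: "(\<Sum>t<q. y $ Suc t) = - r * y $ 0"
    using dim by (simp add: scalar_prod_Suc add_eq_0_iff2 mult.commute)
  \<comment> \<open>Testing against all the shifts \<open>x^j g\<close> of the generator polynomial makes the transform of
    the sequence \<open>g(\<zeta>^i) y(\<zeta>^-i)\<close> vanish.\<close>
  define A where "A i = poly (map_poly emb g) (\<zeta> ^ i) * spectrum (\<lambda>t. y $ Suc t) (q - i)" for i
  have "dft A j = 0" for j
  proof -
    define c where "c = wrap_coeff (monom 1 j * g)"
    have c: "spectrum c i = \<zeta> ^ (j * i) * poly (map_poly emb g) (\<zeta> ^ i)" for i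
      unfolding c_def spectrum_wrap_coeff
      by (simp add: P.hom_mult poly_monom mult.commute flip: power_mult)
    have Z: "Z \<subseteq> {1..<q}" using g by (simp add: zeros_poly_def)
    have c0: "spectrum c 0 = 0" and cZ: "\<And>i. i \<in> Z \<Longrightarrow> spectrum c i = 0"
      using zeros_poly_eval[OF g] Z q_pos unfolding c by (force, force)
    define x where "x = vec (Suc q) (\<lambda>t. if t = 0 then 0 else c (t - 1))"
    have x: "spectrum (\<lambda>t. x $ Suc t) i = spectrum c i" for i
      by (rule spectrum_cong) (simp add: x_def)
    have "x \<in> ext_code Z r (of_nat q)"
      using c0 cZ x spectrum_0_eq_0_iff[of "\<lambda>t. x $ Suc t"] by (auto simp: ext_code_def) (auto simp: x_def)
    from orth[OF this] have "(\<Sum>t<q. c t * y $ Suc t) = 0"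
      using dim by (subst (asm) scalar_prod_Suc) (auto simp: x_def mult.commute)
    then have "0 = (\<Sum>i<q. spectrum c i * spectrum (\<lambda>t. y $ Suc t) (q - i))"
      by (simp add: spectrum_parseval)
    also have "\<dots> = dft A j"
      unfolding dft_def A_def c by (intro sum.cong refl) (simp only: ac_simps)
    finally show ?thesis by simp
  qed
  then have A: "A i = 0" if "i < q" for i
    using dft_injective that by blast
  have "spectrum (\<lambda>t. y $ Suc t) i = 0" if i: "i \<in> {1..<q}" "q - i \<notin> Z" for i
  proof -
    have "A (q - i) = 0" using i by (intro A) simp
    moreover have "poly (map_poly emb g) (\<zeta> ^ (q - i)) \<noteq> 0"
      using zeros_poly_eval[OF g, of "q - i"] i by auto
    ultimately show ?thesis using i by (simp add: A_def)
  qed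
  then show "y \<in> ext_code {i \<in> {1..<q}. q - i \<notin> Z} 1 (- r)"
    using dim sum by (simp add: ext_code_def)
next
  fix y assume y: "y \<in> ext_code {i \<in> {1..<q}. q - i \<notin> Z} 1 (- r)"
  then have dim: "y \<in> carrier_vec (Suc q)" and y0: "(\<Sum>t<q. y $ Suc t) = - r * y $ 0"
    and yZ: "\<And>i. i \<in> {1..<q} \<Longrightarrow> q - i \<notin> Z \<Longrightarrow> spectrum (\<lambda>t. y $ Suc t) i = 0"
    by (auto simp: ext_code_def)
  have "y \<bullet> x = 0" if "x \<in> ext_code Z r (of_nat q)" for x
  proof -
    from that have dim': "x \<in> carrier_vec (Suc q)" and x0: "r * (\<Sum>t<q. x $ Suc t) = of_nat q * x $ 0"
      and xZ: "\<And>i. i \<in> Z \<Longrightarrow> spectrum (\<lambda>t. x $ Suc t) i = 0"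
      by (auto simp: ext_code_def)
    let ?X = "spectrum (\<lambda>t. x $ Suc t)" and ?Y = "spectrum (\<lambda>t. y $ Suc t)"
    have "(\<Sum>i<q. ?X i * ?Y (q - i)) = (\<Sum>i\<in>{0}. ?X i * ?Y (q - i))"
    proof (intro sum.mono_neutral_right ballI)
      fix i assume "i \<in> {..<q} - {0}"
      then have "q - i \<in> {1..<q}" "q - (q - i) = i" by auto
      then show "?X i * ?Y (q - i) = 0"
        using xZ[of i] yZ[of "q - i"] by (cases "i \<in> Z") simp_all
    qed (use q_pos in auto)
    moreover have "?Y q = ?Y 0"
      unfolding spectrum_def by (rule dft_index_cong) simp
    ultimately have "of_nat q * emb (\<Sum>t<q. x $ Suc t * y $ Suc t) = emb (\<Sum>t<q. x $ Suc t) * emb (\<Sum>t<q. y $ Suc t)"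
      by (simp add: spectrum_parseval spectrum_0)
    then have "emb (of_nat q * (\<Sum>t<q. x $ Suc t * y $ Suc t)) = emb ((\<Sum>t<q. x $ Suc t) * (\<Sum>t<q. y $ Suc t))"
      by (simp only: hom_mult hom_of_nat)
    then have "of_nat q * (\<Sum>t<q. x $ Suc t * y $ Suc t) = (\<Sum>t<q. x $ Suc t) * (\<Sum>t<q. y $ Suc t)"
      by simp
    also have "\<dots> = - (y $ 0 * (r * (\<Sum>t<q. x $ Suc t)))"
      unfolding y0 by (simp add: algebra_simps)
    also have "\<dots> = of_nat q * (- (y $ 0 * x $ 0))"
      unfolding x0 by simp
    finally have "(\<Sum>t<q. x $ Suc t * y $ Suc t) = - (y $ 0 * x $ 0)"
      using q_unit_base mult_left_cancel by blast
    then show ?thesis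
      by (simp add: scalar_prod_Suc[OF dim dim'] mult.commute)
  qed
  then show "y \<in> dual_code (Suc q) (ext_code Z r (of_nat q))"
    using dim by (simp add: dual_code_def)
qed

lemma even_code_self_orthogonal:
  assumes Z: "\<And>i. i \<in> {1..<q} \<Longrightarrow> i \<notin> Z \<Longrightarrow> q - i \<in> Z"
  shows "even_code Z \<subseteq> dual_code q (even_code Z)"
proof
  fix y assume y: "y \<in> even_code Z"
  have "y \<bullet> x = 0" if x: "x \<in> even_code Z" for x
  proof -
    have "spectrum (($) y) i * spectrum (($) x) (q - i) = 0" if "i < q" for i
      using x y Z[of i] that by (cases "i \<in> insert 0 Z") (auto simp: even_code_def)
    then have "(\<Sum>i<q. spectrum (($) y) i * spectrum (($) x) (q - i)) = 0"
      by (intro sum.neutral) simp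
    then have "(\<Sum>t<q. y $ t * x $ t) = 0"
      unfolding spectrum_parseval using q_unit by simp
    then show ?thesis
      using x by (auto simp: even_code_def scalar_prod_def atLeast0LessThan)
  qed
  then show "y \<in> dual_code q (even_code Z)"
    using y by (simp add: dual_code_def even_code_def)
qed

text \<open>Multiplication of the positions of the cyclic coordinates by a unit \<open>c\<close> modulo \<open>q\<close> and of the coordinate
  at infinity by a constant, which is the monomial equivalence between the extended codes.\<close>

lemma ext_code_monomial:
  assumes c: "coprime c q" and Z: "\<And>i. i \<in> {1..<q} \<Longrightarrow> c * i mod q \<in> Z' \<longleftrightarrow> i \<in> Z"
    and sub: "Z \<subseteq> {1..<q}" "Z' \<subseteq> {1..<q}" and b: "b = b' * d"
    and x: "x \<in> carrier_vec (Suc q)"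
  shows "vec (Suc q) (\<lambda>t. if t = 0 then d * x $ 0 else x $ Suc (c * (t - 1) mod q)) \<in> ext_code Z' a b'
    \<longleftrightarrow> x \<in> ext_code Z a b"
    (is "?x' \<in> _ \<longleftrightarrow> _")
proof -
  have spec: "spectrum (\<lambda>t. ?x' $ Suc t) (c * i mod q) = spectrum (\<lambda>t. x $ Suc t) i" for i
  proof -
    have "spectrum (\<lambda>t. ?x' $ Suc t) (c * i mod q) = spectrum (\<lambda>t. x $ Suc (c * t mod q)) (c * i mod q)"
      by (rule spectrum_cong) simp
    also have "\<dots> = spectrum (\<lambda>t. x $ Suc (c * t mod q)) (c * i)"
      unfolding spectrum_def by (rule dft_index_cong) simp
    also have "\<dots> = spectrum (\<lambda>t. x $ Suc t) i"
      unfolding spectrum_def by (rule dft_permute[OF c])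
    finally show ?thesis .
  qed
  from spec[of 0] have "emb (\<Sum>t<q. ?x' $ Suc t) = emb (\<Sum>t<q. x $ Suc t)"
    by (simp only: mult_0_right mod_0 spectrum_0)
  then have sum: "(\<Sum>t<q. ?x' $ Suc t) = (\<Sum>t<q. x $ Suc t)" by (simp only: eq_iff)
  have "(\<forall>i\<in>Z'. spectrum (\<lambda>t. ?x' $ Suc t) i = 0) \<longleftrightarrow> (\<forall>i\<in>Z. spectrum (\<lambda>t. x $ Suc t) i = 0)"
  proof (intro iffI ballI)
    fix i assume *: "\<forall>i\<in>Z'. spectrum (\<lambda>t. ?x' $ Suc t) i = 0" "i \<in> Z"
    then have "c * i mod q \<in> Z'" using Z[of i] sub by auto
    then show "spectrum (\<lambda>t. x $ Suc t) i = 0" using *(1) spec[of i] by simp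
  next
    fix j assume *: "\<forall>i\<in>Z. spectrum (\<lambda>t. x $ Suc t) i = 0" "j \<in> Z'"
    obtain c' where c': "[c * c' = 1] (mod q)"
      using cong_solve_coprime_nat[OF c] by auto
    define i where "i = c' * j mod q"
    have "[c * i = c * c' * j] (mod q)"
      by (simp add: i_def cong_def mod_mult_right_eq ac_simps)
    also have "[c * c' * j = 1 * j] (mod q)"
      by (intro cong_mult c' cong_refl)
    finally have ij: "c * i mod q = j" using *(2) sub(2) by (auto simp: cong_def)
    have "i \<noteq> 0"
    proof
      assume "i = 0"
      then have "j = 0" using ij by simp
      then show False using *(2) sub(2) by auto
    qed
    moreover have "i < q" using q_pos by (simp add: i_def)
    ultimately have "i \<in> Z" using Z[of i] ij *(2) by auto
    then show "spectrum (\<lambda>t. ?x' $ Suc t) j = 0" using * spec[of i] ij by simp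
  qed
  then show ?thesis
    using x unfolding ext_code_def mem_Collect_eq sum b by (simp add: mult.assoc)
qed

end


section \<open>Evaluation of the coefficient ring\<close>

text \<open>The element \<open>\<xi>\<close> has order \<open>m - 1\<close>, and the type \<open>'m\<close> that determines the ring
  \<open>F\<^sub>p[u]/\<langle>u^m - u\<rangle>\<close> has \<open>m\<close> elements. The facts on roots of unity are used with \<open>\<xi>\<close> and \<open>m - 1\<close> in
  place of \<open>\<zeta>\<close> and \<open>q\<close>.\<close>

locale gray_points = root_of_unity \<xi> "m - 1"
  for \<xi> :: "'p::prime_card mod_ring" and m :: nat +
  fixes ring_type :: "'m::finite itself"
  assumes card_m: "CARD('m) = m"
begin

lemma m_ge_2: "m \<ge> 2"
  using q_pos by simp

text \<open>The roots \<open>0, 1, \<xi>, \<dots>, \<xi>^(m-2)\<close> of \<open>u^m - u\<close>, in the order of the Gray map.\<close>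

definition point :: "nat \<Rightarrow> 'p mod_ring" where
  "point i = (if i = 0 then 0 else \<xi> ^ (i - 1))"

text \<open>Evaluation of a ring element at the \<open>i\<close>-th point; it does not depend on the representative and
  is a ring homomorphism.\<close>

definition ev :: "nat \<Rightarrow> ('p, 'm) gray_ring \<Rightarrow> 'p mod_ring" where
  "ev i r = poly (gray_ring_rep r) (point i)"

lemma inj_on_point: "inj_on point {..<m}"
proof (rule linorder_inj_onI')
  fix i j assume ij: "i \<in> {..<m}" "j \<in> {..<m}" "i < j"
  show "point i \<noteq> point j"
  proof (cases "i = 0")
    case True
    then show ?thesis using ij zeta_nonzero by (simp add: point_def)
  next
    case False
    then have "i - 1 \<in> {..<m - 1}" "j - 1 \<in> {..<m - 1}" "i - 1 \<noteq> j - 1" using ij by auto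
    then have "\<xi> ^ (i - 1) \<noteq> \<xi> ^ (j - 1)" using inj_on_eq_iff[OF inj_on_power] by blast
    then show ?thesis using False ij by (simp add: point_def)
  qed
qed

lemma point_power: "point i ^ (m - 1) = (if i = 0 then 0 else 1)"
proof (cases "i = 0")
  case False
  have "(\<xi> ^ (i - 1)) ^ (m - 1) = (\<xi> ^ (m - 1)) ^ (i - 1)"
    by (simp only: mult.commute flip: power_mult)
  then show ?thesis using False power_q by (simp add: point_def)
qed (use m_ge_2 in \<open>simp add: point_def power_0_left\<close>)

lemma point_root: "poly (u_modulus TYPE('m)) (point i) = 0"
proof -
  have "point i ^ m = point i ^ (m - 1) * point i"
    using m_ge_2 by (metis One_nat_def Suc_1 Suc_leD le_add_diff_inverse2 power_add power_one_right)
  also have "\<dots> = point i"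
    unfolding point_power by (simp add: point_def)
  finally show ?thesis
    by (simp add: u_modulus_def card_m poly_monom)
qed

lemma ev_of_poly [simp]: "ev i (gray_ring_of_poly f) = poly f (point i)"
proof -
  have "poly f (point i)
      = poly (u_modulus TYPE('m) * (f div u_modulus TYPE('m)) + f mod u_modulus TYPE('m)) (point i)"
    by simp
  then show ?thesis
    unfolding poly_add poly_mult point_root ev_def gray_ring_rep_of_poly by simp
qed

lemma gray_ring_exhaust: obtains f where "r = (gray_ring_of_poly f :: ('p, 'm) gray_ring)"
  unfolding gray_ring_of_poly_def by (metis Quotient_abs_rep Quotient_gray_ring)

lemma ev_hom: "comm_ring_hom (ev i)"
proof -
  interpret G: comm_ring_hom "gray_ring_of_poly :: _ \<Rightarrow> ('p, 'm) gray_ring"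
    by (rule gray_ring_of_poly_hom)
  show ?thesis
  proof
    fix x y :: "('p, 'm) gray_ring"
    obtain f g where x: "x = gray_ring_of_poly f" and y: "y = gray_ring_of_poly g"
      by (metis gray_ring_exhaust)
    have "ev i (gray_ring_of_poly (f + g)) = ev i x + ev i y" 
      unfolding x y ev_of_poly by simp
    then show "ev i (x + y) = ev i x + ev i y" by (simp only: x y G.hom_add)
    have "ev i (gray_ring_of_poly (f * g)) = ev i x * ev i y" 
      unfolding x y ev_of_poly by simp
    then show "ev i (x * y) = ev i x * ev i y" by (simp only: x y G.hom_mult)
    show "ev i 0 = 0" using ev_of_poly[of i 0] by (simp only: G.hom_zero poly_0)
    show "ev i 1 = 1" using ev_of_poly[of i 1] by (simp only: G.hom_one poly_1)
  qed
qed

sublocale ev: comm_ring_hom "ev i" for i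
  by (rule ev_hom)

lemma ev_const [simp]: "ev i (gray_ring_const c) = c"
  by (simp add: gray_ring_const_def)

lemma gray_eval_eq: "gray_eval \<xi> r = vec m (\<lambda>i. ev i r)"
  by (rule eq_vecI) (simp_all add: gray_eval_def ev_def point_def card_m)

lemma ev_injective:
  assumes "\<And>i. i < m \<Longrightarrow> ev i r = ev i s"
  shows "r = s"
proof -
  obtain f g where r: "r = gray_ring_of_poly f" and s: "s = gray_ring_of_poly g"
    by (metis gray_ring_exhaust)
  let ?u = "u_modulus TYPE('m) :: 'p mod_ring poly"
  define d where "d = (f - g) mod ?u"
  have deg: "degree ?u = m"
    unfolding u_modulus_def card_m using m_ge_2
    unfolding diff_conv_add_uminus by (subst degree_add_eq_left) (simp_all add: degree_monom_eq)
  have roots: "poly d (point i) = 0" if "i < m" for i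
  proof -
    have "poly (f - g) (point i) = poly (?u * ((f - g) div ?u) + d) (point i)"
      unfolding d_def by simp
    then show ?thesis using assms[OF that] unfolding poly_add poly_mult point_root r s by simp
  qed
  have "d = 0"
  proof (rule ccontr)
    assume "d \<noteq> 0"
    have "m = card (point ` {..<m})" using inj_on_point by (simp add: card_image)
    also have "\<dots> \<le> card {x. poly d x = 0}"
      by (intro card_mono poly_roots_finite \<open>d \<noteq> 0\<close>) (use roots in auto)
    also have "\<dots> \<le> degree d" by (rule poly_roots_degree[OF \<open>d \<noteq> 0\<close>])
    also have "\<dots> < m"
      using degree_mod_less'[of ?u "f - g"] \<open>d \<noteq> 0\<close> deg m_ge_2 unfolding d_def by force
    finally show False by simp
  qed
  then show ?thesis
    unfolding r s gray_ring_of_poly_eq_iff d_def by (simp add: mod_eq_0_iff_dvd)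
qed

lemma ev_surjective: obtains r where "\<And>i. i < m \<Longrightarrow> ev i r = w i"
proof -
  \<comment> \<open>Lagrange interpolation.\<close>
  define L where "L i = (\<Prod>j\<in>{..<m} - {i}. [:- point j, 1:])" for i
  define r where "r = (gray_ring_of_poly (\<Sum>i<m. Polynomial.smult (w i / poly (L i) (point i)) (L i)) :: ('p, 'm) gray_ring)"
  have L0: "poly (L i) (point k) = 0 \<longleftrightarrow> k \<noteq> i" if "i < m" "k < m" for i k
    using inj_on_point that by (auto simp: L_def poly_prod inj_on_def)
  have "ev k r = w k" if k: "k < m" for k
  proof -
    have "ev k r = (\<Sum>i<m. w i / poly (L i) (point i) * poly (L i) (point k))"
      by (simp add: r_def poly_sum)
    also have "\<dots> = (\<Sum>i\<in>{k}. w i / poly (L i) (point i) * poly (L i) (point k))"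
      using k L0 by (intro sum.mono_neutral_right) auto
    also have "\<dots> = w k" using L0[OF k k] by simp
    finally show ?thesis .
  qed
  then show thesis by (rule that)
qed

text \<open>The idempotent \<open>\<eta>\<^bsub>j\<^esub>\<close> is \<open>1\<close> at a single point, which for \<open>j \<ge> 2\<close> is \<open>\<xi>^-(j-2)\<close>.\<close>

lemma ev_eta:
  "ev i (eta \<xi> j) = of_bool (if i = 0 then j = 1 else j \<noteq> 1 \<and> (m - 1) dvd (j - 2) + (i - 1))"
proof (cases "j = 1")
  case True
  then show ?thesis
    by (simp add: eta_def card_m poly_monom point_power del: One_nat_def)
next
  case False
  define n where "n = (j - 2) + (i - 1)"
  have "ev i (eta \<xi> j) = inverse (of_nat (m - 1)) * (\<Sum>k = 1..m - 1. (\<xi> ^ (j - 2) * point i) ^ k)"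
    using False by (simp add: eta_def card_m poly_sum poly_monom power_mult_distrib)
  moreover have "(\<Sum>k = 1..m - 1. (\<xi> ^ (j - 2) * point i) ^ k)
      = (if i \<noteq> 0 \<and> (m - 1) dvd n then of_nat (m - 1) else 0)"
  proof (cases "i = 0")
    case True
    then show ?thesis by (simp add: point_def power_0_left)
  next
    case i: False
    then have w: "\<xi> ^ (j - 2) * point i = \<xi> ^ n"
      unfolding n_def power_add by (simp add: point_def)
    show ?thesis
    proof (cases "(m - 1) dvd n")
      case True
      then have "\<xi> ^ n = 1" by (simp only: power_eq_1_iff)
      then show ?thesis using True i by (simp add: w)
    next
      case nd: False
      then have "\<xi> ^ n \<noteq> 1" by (simp only: power_eq_1_iff) simp
      have "(\<Sum>k = 1..m - 1. (\<xi> ^ n) ^ k) = (\<Sum>k<m - 1. (\<xi> ^ n) ^ Suc k)"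
        by (rule sum.reindex_bij_witness[of _ Suc "\<lambda>k. k - 1"]) auto
      also have "\<dots> = \<xi> ^ n * (\<Sum>k<m - 1. (\<xi> ^ n) ^ k)"
        by (simp add: sum_distrib_left)
      also have "(\<Sum>k<m - 1. (\<xi> ^ n) ^ k) = 0"
      proof -
        have "(\<xi> ^ n - 1) * (\<Sum>k<m - 1. (\<xi> ^ n) ^ k) = (\<xi> ^ n) ^ (m - 1) - 1"
          by (simp only: power_diff_1_eq)
        also have "(\<xi> ^ n) ^ (m - 1) = 1"
          unfolding power_mult[symmetric] power_eq_1_iff by simp
        finally show ?thesis using \<open>\<xi> ^ n \<noteq> 1\<close> by simp
      qed
      finally show ?thesis using nd by (simp add: w)
    qed
  qed
  ultimately show ?thesis using False q_unit by (auto simp: n_def)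
qed

lemma ev_eta_set:
  assumes "I \<subseteq> {1..m}"
  shows "ev i (eta_set \<xi> I) = 0 \<or> ev i (eta_set \<xi> I) = 1"
proof -
  define P where "P j \<longleftrightarrow> (if i = 0 then j = 1 else j \<noteq> 1 \<and> (m - 1) dvd (j - 2) + (i - 1))" for j
  have fin: "finite I" using assms by (rule finite_subset) simp
  have uniq: "j = k" if "j \<in> I" "k \<in> I" "P j" "P k" for j k
  proof (cases "i = 0")
    case False
    have "[j - 2 + (i - 1) = k - 2 + (i - 1)] (mod (m - 1))"
      using that False by (simp add: P_def cong_def)
    then have "[j - 2 = k - 2] (mod (m - 1))" by (simp only: cong_add_rcancel_nat)
    moreover have "j - 2 < m - 1" "k - 2 < m - 1" "j \<ge> 2" "k \<ge> 2"
      using that assms False m_ge_2 by (auto simp: P_def subset_eq le_Suc_eq numeral_2_eq_2)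
    ultimately show ?thesis by (simp add: cong_def)
  qed (use that in \<open>simp add: P_def\<close>)
  have "ev i (eta_set \<xi> I) = (\<Sum>j\<in>I. of_bool (P j))"
    by (simp add: eta_set_def ev.hom_sum ev_eta P_def)
  also have "\<dots> = of_nat (card {j \<in> I. P j})"
    using fin by (simp add: Groups_Big.sum_of_bool_eq Int_def)
  also have "card {j \<in> I. P j} \<le> 1"
    using uniq fin by (auto simp: card_le_Suc0_iff_eq)
  then have "card {j \<in> I. P j} = 0 \<or> card {j \<in> I. P j} = 1" by linarith
  then have "of_nat (card {j \<in> I. P j}) = (0 :: 'p mod_ring) \<or> of_nat (card {j \<in> I. P j}) = (1 :: 'p mod_ring)"
    by (metis of_nat_0 of_nat_1)
  finally show ?thesis .
qed

lemma map_poly_ev_const: "map_poly (ev i) (map_poly gray_ring_const f) = f"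
proof -
  interpret comm_ring_hom "gray_ring_const :: _ \<Rightarrow> ('p, 'm) gray_ring"
    by (rule gray_ring_const_hom)
  show ?thesis by (rule poly_eqI) (simp add: coeff_map_poly)
qed

interpretation EP: map_poly_comm_ring_hom "ev i" for i ..

lemma map_poly_ev_cyclic_modulus [simp]:
  "map_poly (ev i) (cyclic_modulus TYPE('n::finite)) = cyclic_modulus TYPE('n)"
  by (simp add: cyclic_modulus_def EP.hom_minus)

text \<open>Divisibility by \<open>x^n - 1\<close> can be tested at each evaluation point; the quotients are glued by
  interpolation.\<close>

lemma cyclic_modulus_dvd_ev_iff:
  "cyclic_modulus TYPE('n::finite) dvd f
   \<longleftrightarrow> (\<forall>i<m. cyclic_modulus TYPE('n) dvd map_poly (ev i) f)"
proof (intro iffI allI impI)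
  fix i assume "cyclic_modulus TYPE('n) dvd f"
  then have "map_poly (ev i) (cyclic_modulus TYPE('n)) dvd map_poly (ev i) f" by (rule EP.hom_dvd)
  then show "cyclic_modulus TYPE('n) dvd map_poly (ev i) f" by simp
next
  let ?C = "cyclic_modulus TYPE('n) :: ('p, 'm) gray_ring poly"
  assume "\<forall>i<m. cyclic_modulus TYPE('n) dvd map_poly (ev i) f"
  then obtain k where k: "\<And>i. i < m \<Longrightarrow> map_poly (ev i) f = cyclic_modulus TYPE('n) * k i"
    unfolding dvd_def by metis
  have "\<exists>r. \<forall>j<m. ev j r = of_bool (j = i)" for i
    using ev_surjective[of "\<lambda>j. of_bool (j = i)"] by blast
  then have "\<exists>\<theta>. \<forall>i. \<forall>j<m. ev j (\<theta> i) = of_bool (j = i)"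
    by (intro choice allI)
  then obtain \<theta> where \<theta>: "\<And>i j. j < m \<Longrightarrow> ev j (\<theta> i) = of_bool (j = i)" by blast
  define K where "K = (\<Sum>i<m. Polynomial.smult (\<theta> i) (map_poly gray_ring_const (k i)))"
  have K: "map_poly (ev j) K = k j" if "j < m" for j
  proof -
    have "map_poly (ev j) K = (\<Sum>i<m. Polynomial.smult (ev j (\<theta> i)) (k i))"
      by (simp add: K_def EP.hom_sum ev.map_poly_hom_smult map_poly_ev_const)
    also have "\<dots> = (\<Sum>i\<in>{j}. Polynomial.smult (ev j (\<theta> i)) (k i))"
      using that \<theta> by (intro sum.mono_neutral_right) auto
    also have "\<dots> = k j" using that \<theta> by simp
    finally show ?thesis .
  qed
  have "f = ?C * K"
  proof (rule poly_eqI)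
    fix n
    show "coeff f n = coeff (?C * K) n"
    proof (rule ev_injective)
      fix i assume "i < m"
      then have "map_poly (ev i) f = map_poly (ev i) (?C * K)"
        by (simp add: k K EP.hom_mult)
      then show "ev i (coeff f n) = ev i (coeff (?C * K) n)"
        by (metis coeff_map_poly ev.hom_zero)
    qed
  qed
  then show "?C dvd f" by simp
qed

text \<open>The ideal of \<open>\<eta> a + (1 - \<eta>) b\<close> is the ideal of \<open>a\<close> at the points where \<open>\<eta>\<close> is \<open>1\<close> and that of \<open>b\<close>
  at the points where \<open>\<eta>\<close> is \<open>0\<close>. Idempotency turns membership into the equation \<open>e x = x\<close>, which
  can be checked pointwise.\<close>

lemma idempotent_mix_dvd_iff:
  fixes a b :: "('p mod_ring, 'n::finite) cyclic_ring"
  assumes a: "a * a = a" and b: "b * b = b"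
    and \<eta>: "\<And>i. i < m \<Longrightarrow> ev i \<eta> = 0 \<or> ev i \<eta> = 1"
  shows "idempotent_mix \<eta> a b dvd cyclic_ring_of_poly f
    \<longleftrightarrow> (\<forall>i<m. (if ev i \<eta> = 1 then a else b) dvd cyclic_ring_of_poly (map_poly (ev i) f))"
proof -
  interpret R: comm_ring_hom "cyclic_ring_of_poly :: _ \<Rightarrow> (('p, 'm) gray_ring, 'n) cyclic_ring"
    by (rule cyclic_ring_of_poly_hom)
  interpret F: comm_ring_hom "cyclic_ring_of_poly :: _ \<Rightarrow> ('p mod_ring, 'n) cyclic_ring"
    by (rule cyclic_ring_of_poly_hom)
  define E where "E = [:\<eta>:] * map_poly gray_ring_const (rep_cyclic_ring a)
    + [:1 - \<eta>:] * map_poly gray_ring_const (rep_cyclic_ring b)"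
  define e where "e i = (if ev i \<eta> = 1 then a else b)" for i
  have rep: "cyclic_ring_of_poly (rep_cyclic_ring c) = c" for c :: "('p mod_ring, 'n) cyclic_ring"
    unfolding cyclic_ring_of_poly_def by (rule Quotient_abs_rep[OF Quotient_cyclic_ring])
  have E: "idempotent_mix \<eta> a b = cyclic_ring_of_poly E"
    by (simp only: idempotent_mix_def cyclic_ring_incl_def E_def R.hom_add R.hom_mult)
  have evE: "cyclic_ring_of_poly (map_poly (ev i) E) = e i" if "i < m" for i
    using \<eta>[OF that]
    by (auto simp: E_def e_def EP.hom_add EP.hom_mult ev.map_poly_hom_smult map_poly_ev_const rep ev.hom_minus)
  have e: "e i * e i = e i" for i using a b by (simp add: e_def)
  show ?thesis
    unfolding E e_def[symmetric]
  proof (intro iffI allI impI)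
    fix i assume i: "i < m"
    assume "cyclic_ring_of_poly E dvd (cyclic_ring_of_poly f :: (('p, 'm) gray_ring, 'n) cyclic_ring)"
    then obtain h :: "(('p, 'm) gray_ring, 'n) cyclic_ring"
      where h: "cyclic_ring_of_poly f = cyclic_ring_of_poly E * h" by (rule dvdE)
    obtain h' where h': "h = cyclic_ring_of_poly h'"
      unfolding cyclic_ring_of_poly_def by (metis Quotient_abs_rep Quotient_cyclic_ring)
    have "cyclic_ring_of_poly f = (cyclic_ring_of_poly (E * h') :: (('p, 'm) gray_ring, 'n) cyclic_ring)"
      by (simp only: h h' R.hom_mult)
    then have "cyclic_modulus TYPE('n) dvd f - E * h'"
      by (simp only: cyclic_ring_of_poly_eq_iff)
    then have "cyclic_modulus TYPE('n) dvd map_poly (ev i) f - map_poly (ev i) E * map_poly (ev i) h'"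
      using i by (simp add: cyclic_modulus_dvd_ev_iff EP.hom_minus EP.hom_mult)
    then have "cyclic_ring_of_poly (map_poly (ev i) f) = e i * cyclic_ring_of_poly (map_poly (ev i) h')"
      unfolding cyclic_ring_of_poly_eq_iff[symmetric, where 'n = 'n] F.hom_mult evE[OF i] .
    then show "e i dvd cyclic_ring_of_poly (map_poly (ev i) f)" by simp
  next
    assume *: "\<forall>i<m. e i dvd cyclic_ring_of_poly (map_poly (ev i) f)"
    have "cyclic_modulus TYPE('n) dvd map_poly (ev i) (f - E * f)" if i: "i < m" for i
    proof -
      from * i obtain k where k: "cyclic_ring_of_poly (map_poly (ev i) f) = e i * k" by (auto elim: dvdE)
      then have "cyclic_ring_of_poly (map_poly (ev i) f) = e i * cyclic_ring_of_poly (map_poly (ev i) f)"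
        by (simp add: e flip: mult.assoc)
      then have "cyclic_ring_of_poly (map_poly (ev i) f)
          = (cyclic_ring_of_poly (map_poly (ev i) (E * f)) :: ('p mod_ring, 'n) cyclic_ring)"
        by (simp add: EP.hom_mult F.hom_mult evE[OF i])
      then show ?thesis unfolding cyclic_ring_of_poly_eq_iff EP.hom_minus .
    qed
    then have "cyclic_modulus TYPE('n) dvd f - E * f"
      unfolding cyclic_modulus_dvd_ev_iff by blast
    then have "cyclic_ring_of_poly f = (cyclic_ring_of_poly (E * f) :: (('p, 'm) gray_ring, 'n) cyclic_ring)"
      by (simp only: cyclic_ring_of_poly_eq_iff)
    then show "cyclic_ring_of_poly E dvd (cyclic_ring_of_poly f :: (('p, 'm) gray_ring, 'n) cyclic_ring)"
      unfolding R.hom_mult by (rule dvdI)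
  qed
qed

text \<open>The code of length \<open>n\<close> over the ring with component \<open>C i\<close> at the \<open>i\<close>-th evaluation point.\<close>

definition component_code :: "nat \<Rightarrow> (nat \<Rightarrow> 'p mod_ring vec set) \<Rightarrow> ('p, 'm) gray_ring vec set" where
  "component_code n C = {x \<in> carrier_vec n. \<forall>i<m. map_vec (ev i) x \<in> C i}"

end


section \<open>Linear codes and dual codes\<close>

lemma module_module_vec: "module class_ring (module_vec TYPE('a::comm_ring_1) n)"
proof -
  interpret vec_module "TYPE('a)" n .
  show ?thesis by (rule module_axioms)
qed

lemma linear_code_iff:
  "linear_code n C \<longleftrightarrow> C \<subseteq> carrier_vec n \<and> 0\<^sub>v n \<in> C
     \<and> (\<forall>x\<in>C. \<forall>y\<in>C. x + y \<in> C) \<and> (\<forall>c. \<forall>x\<in>C. c \<cdot>\<^sub>v x \<in> C)"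
  unfolding linear_code_def submodule_def
  by (auto simp: module_vec_simps module_module_vec)

lemma linear_code_span:
  assumes "G \<subseteq> carrier_vec n"
  shows "linear_code n (code_span n G)" "G \<subseteq> code_span n G"
    and "linear_code n C \<Longrightarrow> G \<subseteq> C \<Longrightarrow> code_span n G \<subseteq> C"
  using module.span_is_submodule[OF module_module_vec, of G n]
    module.in_own_span[OF module_module_vec, of G n]
    module.span_is_subset[OF module_module_vec, of G C n] assms
  by (simp_all add: linear_code_def code_span_def module_vec_simps)

text \<open>The Gray image of a word of length \<open>n\<close> consists of \<open>n\<close> blocks of length \<open>m\<close>.\<close>

lemma sum_blocks:
  fixes f :: "nat \<Rightarrow> 'a::comm_monoid_add"
  shows "(\<Sum>k<m * n. f k) = (\<Sum>t<n. \<Sum>j<m. f (t * m + j))"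
proof -
  have "(\<Sum>k<m * n. f k) = (\<Sum>t<n. sum f {t * m..<t * m + m})"
    by (subst sum.nat_group) (simp add: mult.commute)
  moreover have "sum f {t * m..<t * m + m} = (\<Sum>j<m. f (t * m + j))" for t
    using sum.shift_bounds_nat_ivl[of f 0 "t * m" m]
    by (simp add: atLeast0LessThan add.commute)
  ultimately show ?thesis by simp
qed

lemma block_index_less:
  fixes t j m n :: nat
  assumes "t < n" "j < m"
  shows "t * m + j < m * n"
proof -
  have "t * m + j < Suc t * m" using assms(2) by simp
  also have "\<dots> \<le> m * n" using assms(1) by (metis Suc_leI mult.commute mult_le_mono1)
  finally show ?thesis .
qed

lemma hamming_weight_sum: "hamming_weight v = (\<Sum>i<dim_vec v. of_bool (v $ i \<noteq> 0))"
proof -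
  have "{i. i < dim_vec v \<and> v $ i \<noteq> 0} = {..<dim_vec v} \<inter> {i. v $ i \<noteq> 0}" by auto
  then show ?thesis by (simp add: hamming_weight_def)
qed

context gray_points
begin

lemma linear_component_code:
  assumes "\<And>i. i < m \<Longrightarrow> linear_code n (C i)"
  shows "linear_code n (component_code n C)"
proof -
  have z: "map_vec (ev i) (0\<^sub>v n) = 0\<^sub>v n" for i by (rule eq_vecI) auto
  have a: "map_vec (ev i) (x + y) = map_vec (ev i) x + map_vec (ev i) y"
    if "x \<in> carrier_vec n" "y \<in> carrier_vec n" for i x y
    using that by (intro eq_vecI) (auto simp: ev.hom_add)
  have s: "map_vec (ev i) (c \<cdot>\<^sub>v x) = ev i c \<cdot>\<^sub>v map_vec (ev i) x" for i c x
    by (intro eq_vecI) (auto simp: ev.hom_mult)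
  show ?thesis
    using assms unfolding linear_code_iff component_code_def by (auto simp: z a s)
qed

end

section \<open>The Gray map\<close>

text \<open>The matrix of the Gray map, orthogonal up to the factor \<open>lam\<close>.\<close>

locale gray_isometry = gray_points \<xi> m ring_type
  for \<xi> :: "'p::prime_card mod_ring" and m :: nat and ring_type :: "'m::finite itself" +
  fixes V :: "'p mod_ring mat" and lam :: "'p mod_ring"
  assumes V: "V \<in> carrier_mat m m" and lam: "lam \<noteq> 0"
    and VVT: "V * transpose_mat V = lam \<cdot>\<^sub>m 1\<^sub>m m"
begin

abbreviation gray :: "('p, 'm) gray_ring vec \<Rightarrow> 'p mod_ring vec" where
  "gray \<equiv> gray_map_vec V \<xi>"

lemma rows_orthogonal:
  assumes "i < m" "k < m"
  shows "(\<Sum>j<m. V $$ (i, j) * V $$ (k, j)) = lam * of_bool (i = k)"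
proof -
  have "(V * transpose_mat V) $$ (i, k) = (\<Sum>j<m. V $$ (i, j) * V $$ (k, j))"
    using V assms by (simp add: scalar_prod_def atLeast0LessThan)
  moreover have "(V * transpose_mat V) $$ (i, k) = lam * of_bool (i = k)"
    using assms by (simp add: VVT)
  ultimately show ?thesis by (simp only:)
qed

lemma columns_orthogonal:
  assumes "j < m" "k < m"
  shows "(\<Sum>i<m. V $$ (i, j) * V $$ (i, k)) = lam * of_bool (j = k)"
proof -
  have VT: "inverse lam \<cdot>\<^sub>m transpose_mat V \<in> carrier_mat m m" using V by simp
  have "V * (inverse lam \<cdot>\<^sub>m transpose_mat V) = inverse lam \<cdot>\<^sub>m (lam \<cdot>\<^sub>m 1\<^sub>m m)"
    unfolding VVT[symmetric] using V by (simp add: mult_smult_distrib[of V m m _ m])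
  also have "\<dots> = 1\<^sub>m m" using lam by (intro eq_matI) auto
  finally have "(inverse lam \<cdot>\<^sub>m transpose_mat V) * V = 1\<^sub>m m"
    by (rule mat_mult_left_right_inverse[OF V VT])
  moreover have "((inverse lam \<cdot>\<^sub>m transpose_mat V) * V) $$ (j, k)
      = inverse lam * (\<Sum>i<m. V $$ (i, j) * V $$ (i, k))"
    using V assms by (simp add: scalar_prod_def atLeast0LessThan sum_distrib_left mult.assoc)
  ultimately have "inverse lam * (\<Sum>i<m. V $$ (i, j) * V $$ (i, k)) = of_bool (j = k)"
    using assms by (cases "j = k") simp_all
  then have "lam * (inverse lam * (\<Sum>i<m. V $$ (i, j) * V $$ (i, k))) = lam * of_bool (j = k)"
    by (simp only:)
  then show ?thesis using lam by (simp flip: mult.assoc)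
qed

lemma gray_map_index:
  assumes "j < m"
  shows "gray_map V \<xi> r $ j = (\<Sum>i<m. ev i r * V $$ (i, j))"
  using assms V by (simp add: gray_map_def card_m gray_eval_eq scalar_prod_def atLeast0LessThan)

lemma gray_carrier: "x \<in> carrier_vec n \<Longrightarrow> gray x \<in> carrier_vec (m * n)"
  by (auto simp: gray_map_vec_def card_m)

lemma gray_index:
  assumes "x \<in> carrier_vec n" "t < n" "j < m"
  shows "gray x $ (t * m + j) = gray_map V \<xi> (x $ t) $ j"
  using assms block_index_less[OF assms(2,3)] by (simp add: gray_map_vec_def card_m)

lemma eq_blockI:
  assumes "y \<in> carrier_vec (m * n)" "z \<in> carrier_vec (m * n)"
    and "\<And>t j. t < n \<Longrightarrow> j < m \<Longrightarrow> y $ (t * m + j) = z $ (t * m + j)"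
  shows "y = z"
proof (rule eq_vecI)
  fix k assume "k < dim_vec z"
  then have k: "k < m * n" using assms(2) by simp
  then have "k div m < n" by (simp add: less_mult_imp_div_less mult.commute)
  moreover have "k mod m < m" using k by (cases m) auto
  ultimately show "y $ k = z $ k" using assms(3)[of "k div m" "k mod m"] by simp
qed (use assms in auto)

lemma gray_add:
  assumes "x \<in> carrier_vec n" "y \<in> carrier_vec n"
  shows "gray (x + y) = gray x + gray y"
proof (rule eq_blockI)
  fix t j assume tj: "t < n" "j < m"
  then have "t * m + j < m * n" by (rule block_index_less)
  then have "(gray x + gray y) $ (t * m + j) = gray x $ (t * m + j) + gray y $ (t * m + j)"
    using gray_carrier[OF assms(2)] by (intro index_add_vec) simp
  then show "gray (x + y) $ (t * m + j) = (gray x + gray y) $ (t * m + j)"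
    using assms tj
    by (simp add: gray_index[of _ n] gray_map_index ev.hom_add distrib_right sum.distrib)
qed (use assms gray_carrier in auto)

lemma gray_smult:
  assumes "x \<in> carrier_vec n"
  shows "gray (gray_ring_const c \<cdot>\<^sub>v x) = c \<cdot>\<^sub>v gray x"
proof (rule eq_blockI)
  fix t j assume tj: "t < n" "j < m"
  then have "t * m + j < m * n" by (rule block_index_less)
  then have "(c \<cdot>\<^sub>v gray x) $ (t * m + j) = c * gray x $ (t * m + j)"
    using gray_carrier[OF assms] by (intro index_smult_vec) simp
  then show "gray (gray_ring_const c \<cdot>\<^sub>v x) $ (t * m + j) = (c \<cdot>\<^sub>v gray x) $ (t * m + j)"
    using assms tj
    by (simp add: gray_index[of _ n] gray_map_index ev.hom_mult sum_distrib_left mult.assoc)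
qed (use assms gray_carrier in auto)

lemma gray_zero: "gray (0\<^sub>v n) = 0\<^sub>v (m * n)"
proof (rule eq_blockI)
  fix t j assume tj: "t < n" "j < m"
  show "gray (0\<^sub>v n) $ (t * m + j) = 0\<^sub>v (m * n) $ (t * m + j)"
    using tj block_index_less[OF tj] by (simp add: gray_index[of _ n] gray_map_index)
qed (use gray_carrier in auto)

text \<open>Up to the factor \<open>lam\<close>, the Gray map preserves the inner product of the components.\<close>

lemma gray_scalar_prod:
  assumes x: "x \<in> carrier_vec n" and y: "y \<in> carrier_vec n"
  shows "gray x \<bullet> gray y = lam * (\<Sum>i<m. map_vec (ev i) x \<bullet> map_vec (ev i) y)"
proof -
  have "gray x \<bullet> gray y = (\<Sum>t<n. \<Sum>j<m. gray x $ (t * m + j) * gray y $ (t * m + j))"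
    using gray_carrier[OF y] by (simp add: scalar_prod_def atLeast0LessThan sum_blocks)
  also have "\<dots> = (\<Sum>t<n. \<Sum>i<m. lam * (ev i (x $ t) * ev i (y $ t)))"
  proof (rule sum.cong[OF refl])
    fix t assume "t \<in> {..<n}"
    then have t: "t < n" by simp
    have "(\<Sum>j<m. gray x $ (t * m + j) * gray y $ (t * m + j))
        = (\<Sum>j<m. \<Sum>i<m. \<Sum>k<m. ev i (x $ t) * ev k (y $ t) * (V $$ (i, j) * V $$ (k, j)))"
      using x y t by (simp add: gray_index gray_map_index sum_product) (simp add: mult_ac)
    also have "\<dots> = (\<Sum>i<m. \<Sum>j<m. \<Sum>k<m. ev i (x $ t) * ev k (y $ t) * (V $$ (i, j) * V $$ (k, j)))"
      by (rule sum.swap)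
    also have "\<dots> = (\<Sum>i<m. \<Sum>k<m. \<Sum>j<m. ev i (x $ t) * ev k (y $ t) * (V $$ (i, j) * V $$ (k, j)))"
      by (intro sum.cong refl sum.swap)
    also have "\<dots> = (\<Sum>i<m. \<Sum>k<m. ev i (x $ t) * ev k (y $ t) * (lam * of_bool (i = k)))"
      by (intro sum.cong refl) (simp only: sum_distrib_left[symmetric] rows_orthogonal lessThan_iff)
    also have "\<dots> = (\<Sum>i<m. \<Sum>k<m. if i = k then lam * (ev i (x $ t) * ev i (y $ t)) else 0)"
      by (intro sum.cong refl) (auto simp: of_bool_def)
    also have "\<dots> = (\<Sum>i<m. lam * (ev i (x $ t) * ev i (y $ t)))"
      by (intro sum.cong refl) (simp add: sum.delta)
    finally show "(\<Sum>j<m. gray x $ (t * m + j) * gray y $ (t * m + j))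
        = (\<Sum>i<m. lam * (ev i (x $ t) * ev i (y $ t)))" .
  qed
  also have "\<dots> = (\<Sum>i<m. \<Sum>t<n. lam * (ev i (x $ t) * ev i (y $ t)))"
    by (rule sum.swap)
  also have "\<dots> = lam * (\<Sum>i<m. map_vec (ev i) x \<bullet> map_vec (ev i) y)"
    using x y by (simp add: scalar_prod_def atLeast0LessThan sum_distrib_left)
  finally show ?thesis .
qed

lemma gray_injective: "inj_on gray (carrier_vec n)"
proof (rule inj_onI)
  fix x y assume x: "x \<in> carrier_vec n" and y: "y \<in> carrier_vec n" and eq: "gray x = gray y"
  have rec: "(\<Sum>j<m. V $$ (k, j) * gray z $ (t * m + j)) = lam * ev k (z $ t)"
    if z: "z \<in> carrier_vec n" "t < n" "k < m" for z t k
  proof -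
    have "(\<Sum>j<m. V $$ (k, j) * gray z $ (t * m + j))
        = (\<Sum>j<m. \<Sum>i<m. ev i (z $ t) * (V $$ (i, j) * V $$ (k, j)))"
      using z by (simp add: gray_index gray_map_index sum_distrib_left) (simp add: mult_ac)
    also have "\<dots> = (\<Sum>i<m. \<Sum>j<m. ev i (z $ t) * (V $$ (i, j) * V $$ (k, j)))"
      by (rule sum.swap)
    also have "\<dots> = (\<Sum>i<m. ev i (z $ t) * (lam * of_bool (i = k)))"
      using z(3) by (intro sum.cong refl) (simp only: sum_distrib_left[symmetric] rows_orthogonal lessThan_iff)
    also have "\<dots> = (\<Sum>i<m. if i = k then lam * ev k (z $ t) else 0)"
      by (intro sum.cong refl) auto
    finally show ?thesis using z(3) by simp
  qed
  show "x = y"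
  proof (rule eq_vecI)
    fix t assume "t < dim_vec y"
    then have t: "t < n" using y by simp
    show "x $ t = y $ t"
    proof (rule ev_injective)
      fix k assume "k < m"
      then show "ev k (x $ t) = ev k (y $ t)"
        using rec[OF x t] rec[OF y t] lam by (metis eq mult_left_cancel)
    qed
  qed (use x y in auto)
qed

lemma gray_surjective:
  assumes y: "y \<in> carrier_vec (m * n)"
  obtains x where "x \<in> carrier_vec n" "gray x = y"
proof -
  have "\<exists>r. \<forall>i<m. ev i r = inverse lam * (\<Sum>k<m. V $$ (i, k) * y $ (t * m + k))" for t
    using ev_surjective[of "\<lambda>i. inverse lam * (\<Sum>k<m. V $$ (i, k) * y $ (t * m + k))"] by blast
  then obtain w where w: "\<And>t i. i < m \<Longrightarrow> ev i (w t) = inverse lam * (\<Sum>k<m. V $$ (i, k) * y $ (t * m + k))"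
    by metis
  define x where "x = vec n w"
  have x: "x \<in> carrier_vec n" by (simp add: x_def)
  have "gray x = y"
  proof (rule eq_blockI)
    fix t j assume tj: "t < n" "j < m"
    have "gray x $ (t * m + j)
        = (\<Sum>i<m. \<Sum>k<m. inverse lam * y $ (t * m + k) * (V $$ (i, j) * V $$ (i, k)))"
      using tj x by (simp add: gray_index[of _ n] gray_map_index)
        (simp add: x_def w sum_distrib_left sum_distrib_right mult_ac)
    also have "\<dots> = (\<Sum>k<m. \<Sum>i<m. inverse lam * y $ (t * m + k) * (V $$ (i, j) * V $$ (i, k)))"
      by (rule sum.swap)
    also have "\<dots> = (\<Sum>k<m. inverse lam * y $ (t * m + k) * (lam * of_bool (j = k)))"
      using tj by (intro sum.cong refl) (simp only: sum_distrib_left[symmetric] columns_orthogonal lessThan_iff)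
    also have "\<dots> = (\<Sum>k<m. if j = k then y $ (t * m + j) else 0)"
      using lam by (intro sum.cong refl) auto
    finally show "gray x $ (t * m + j) = y $ (t * m + j)" using tj by simp
  qed (use x y gray_carrier in auto)
  with x show thesis by (rule that)
qed

lemma linear_gray_code:
  assumes C: "linear_code n C"
  shows "linear_code (m * n) (gray ` C)"
proof -
  have sub: "C \<subseteq> carrier_vec n" using C by (simp add: linear_code_iff)
  have "gray x + gray y \<in> gray ` C" if "x \<in> C" "y \<in> C" for x y
  proof (rule image_eqI)
    show "gray x + gray y = gray (x + y)" using that sub gray_add by (metis subsetD)
    show "x + y \<in> C" using that C by (simp add: linear_code_iff)
  qed
  moreover have "c \<cdot>\<^sub>v gray x \<in> gray ` C" if "x \<in> C" for x c
  proof (rule image_eqI)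
    show "c \<cdot>\<^sub>v gray x = gray (gray_ring_const c \<cdot>\<^sub>v x)" using that sub gray_smult by (metis subsetD)
    show "gray_ring_const c \<cdot>\<^sub>v x \<in> C" using that C by (simp add: linear_code_iff)
  qed
  moreover have "0\<^sub>v (m * n) \<in> gray ` C"
    by (rule image_eqI[of _ _ "0\<^sub>v n"]) (use C in \<open>simp_all add: gray_zero linear_code_iff\<close>)
  ultimately show ?thesis
    using sub gray_carrier unfolding linear_code_iff by auto
qed

text \<open>To isolate the component at one point, test against words that vanish at all other points.\<close>

lemma dual_gray_code:
  assumes C: "\<And>i. i < m \<Longrightarrow> C i \<subseteq> carrier_vec n \<and> 0\<^sub>v n \<in> C i"
  shows "dual_code (m * n) (gray ` component_code n C) = gray ` component_code n (\<lambda>i. dual_code n (C i))"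
proof (intro equalityI subsetI)
  fix y assume y: "y \<in> dual_code (m * n) (gray ` component_code n C)"
  then have "y \<in> carrier_vec (m * n)" by (simp add: dual_code_def)
  then obtain x where x: "x \<in> carrier_vec n" and yx: "y = gray x"
    by (metis gray_surjective)
  have "map_vec (ev i) x \<bullet> c = 0" if i: "i < m" and c: "c \<in> C i" for i c
  proof -
    have "\<exists>r. \<forall>k<m. ev k r = (if k = i then c $ t else 0)" for t
      using ev_surjective[of "\<lambda>k. if k = i then c $ t else 0"] by blast
    then obtain w where w: "\<And>t k. k < m \<Longrightarrow> ev k (w t) = (if k = i then c $ t else 0)"
      by metis
    have c': "c \<in> carrier_vec n" using C i c by blast
    have z: "map_vec (ev k) (vec n w) = (if k = i then c else 0\<^sub>v n)" if "k < m" for k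
      using c' that w by (intro eq_vecI) auto
    have "vec n w \<in> component_code n C"
      using C c z by (auto simp: component_code_def)
    then have "0 = gray x \<bullet> gray (vec n w)"
      using y by (simp add: dual_code_def yx)
    also have "\<dots> = lam * (\<Sum>k<m. map_vec (ev k) x \<bullet> map_vec (ev k) (vec n w))"
      by (rule gray_scalar_prod) (simp_all add: x)
    also have "(\<Sum>k<m. map_vec (ev k) x \<bullet> map_vec (ev k) (vec n w))
        = (\<Sum>k<m. if k = i then map_vec (ev i) x \<bullet> c else 0)"
      using x by (intro sum.cong refl) (auto simp: z)
    finally show ?thesis using lam i by simp
  qed
  then show "y \<in> gray ` component_code n (\<lambda>i. dual_code n (C i))"
    using x by (auto simp: yx component_code_def dual_code_def)
next
  fix y assume "y \<in> gray ` component_code n (\<lambda>i. dual_code n (C i))"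
  then obtain x where x: "x \<in> component_code n (\<lambda>i. dual_code n (C i))" and yx: "y = gray x" by blast
  have "gray x \<bullet> gray z = 0" if z: "z \<in> component_code n C" for z
    using x z by (subst gray_scalar_prod[of _ n]) (auto simp: component_code_def dual_code_def)
  then show "y \<in> dual_code (m * n) (gray ` component_code n C)"
    using x gray_carrier by (auto simp: yx dual_code_def component_code_def)
qed

subsection \<open>Weights\<close>

lemma hamming_weight_gray:
  assumes "x \<in> carrier_vec n"
  shows "hamming_weight (gray x) = (\<Sum>t<n. hamming_weight (gray_map V \<xi> (x $ t)))"
proof -
  have d: "dim_vec (gray x) = m * n" using gray_carrier[OF assms] by simp
  have "dim_vec (gray_map V \<xi> r) = m" for r :: "('p, 'm) gray_ring"
    by (simp add: gray_map_def card_m)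
  then show ?thesis
    unfolding hamming_weight_sum d sum_blocks using assms by (simp add: gray_index)
qed

lemma hamming_weight_gray_map_scale:
  assumes "d \<noteq> 0"
  shows "hamming_weight (gray_map V \<xi> (gray_ring_const d * r :: ('p, 'm) gray_ring))
    = hamming_weight (gray_map V \<xi> r)"
proof -
  have "gray_map V \<xi> (gray_ring_const d * r) $ j = d * gray_map V \<xi> r $ j" if "j < m" for j
    using that by (simp add: gray_map_index ev.hom_mult sum_distrib_left mult.assoc)
  moreover have "dim_vec (gray_map V \<xi> r) = m" for r :: "('p, 'm) gray_ring"
    by (simp add: gray_map_def card_m)
  ultimately show ?thesis
    unfolding hamming_weight_sum using assms by simp
qed

text \<open>A monomial transformation of the coordinates over the ring whose factors are constants
  preserves the weights of the Gray images.\<close>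

lemma weight_enumerator_monomial:
  assumes \<pi>: "bij_betw \<pi> {..<n} {..<n}" and d: "\<And>t. t < n \<Longrightarrow> d t \<noteq> 0"
    and sub: "C \<subseteq> carrier_vec n" "D \<subseteq> carrier_vec n"
    and CD: "\<And>x. x \<in> carrier_vec n \<Longrightarrow>
      vec n (\<lambda>t. gray_ring_const (d t) * x $ \<pi> t) \<in> D \<longleftrightarrow> x \<in> C"
  shows "weight_enumerator N (gray ` C) = weight_enumerator N (gray ` D)"
proof -
  interpret K: comm_ring_hom "gray_ring_const :: _ \<Rightarrow> ('p, 'm) gray_ring"
    by (rule gray_ring_const_hom)
  define T where "T x = vec n (\<lambda>t. gray_ring_const (d t) * x $ \<pi> t)" for x :: "('p, 'm) gray_ring vec"
  define T' where "T' y = vec n (\<lambda>s. gray_ring_const (inverse (d (inv_into {..<n} \<pi> s))) * y $ inv_into {..<n} \<pi> s)"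
    for y :: "('p, 'm) gray_ring vec"
  have \<pi>_less: "\<pi> t < n" if "t < n" for t using bij_betwE[OF \<pi>] that by simp
  have inv_less: "inv_into {..<n} \<pi> s < n" if "s < n" for s
    using bij_betwE[OF bij_betw_inv_into[OF \<pi>]] that by simp
  have const: "gray_ring_const a * (gray_ring_const b * r) = (r :: ('p, 'm) gray_ring)" if "a * b = 1" for a b r
    using that by (simp flip: mult.assoc K.hom_mult)
  have T'T: "T' (T x) = x" if "x \<in> carrier_vec n" for x
  proof (rule eq_vecI)
    fix s assume "s < dim_vec x"
    then have "s < n" using that by simp
    then show "T' (T x) $ s = x $ s"
      using d[of "inv_into {..<n} \<pi> s"] inv_less[of s] bij_betw_inv_into_right[OF \<pi>, of s]
      by (simp add: T_def T'_def const)
  qed (use that in \<open>simp add: T'_def\<close>)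
  have TT': "T (T' y) = y" if "y \<in> carrier_vec n" for y
  proof (rule eq_vecI)
    fix t assume "t < dim_vec y"
    then have "t < n" using that by simp
    then show "T (T' y) $ t = y $ t"
      using d[of t] \<pi>_less[of t] bij_betw_inv_into_left[OF \<pi>, of t]
      by (simp add: T_def T'_def const)
  qed (use that in \<open>simp add: T_def\<close>)
  have carrier: "T x \<in> carrier_vec n" "T' x \<in> carrier_vec n" for x
    by (simp_all add: T_def T'_def)
  have bij: "bij_betw T C D"
  proof (rule bij_betw_byWitness[where f' = T'])
    show "T ` C \<subseteq> D" using CD sub by (auto simp: T_def)
    show "T' ` D \<subseteq> C"
    proof (rule image_subsetI)
      fix y assume y: "y \<in> D"
      then have "T (T' y) \<in> D" using TT' sub by auto
      then show "T' y \<in> C" using CD[OF carrier(2)] by (simp add: T_def)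
    qed
  qed (use T'T TT' sub in auto)
  have wt: "hamming_weight (gray (T x)) = hamming_weight (gray x)" if "x \<in> carrier_vec n" for x
  proof -
    have "hamming_weight (gray (T x)) = (\<Sum>t<n. hamming_weight (gray_map V \<xi> (x $ \<pi> t)))"
      unfolding hamming_weight_gray[OF carrier(1)]
      by (intro sum.cong refl) (simp add: T_def hamming_weight_gray_map_scale d)
    also have "\<dots> = (\<Sum>t<n. hamming_weight (gray_map V \<xi> (x $ t)))"
      by (rule sum.reindex_bij_betw[OF \<pi>])
    finally show ?thesis by (simp add: hamming_weight_gray[OF that])
  qed
  let ?g = "\<lambda>c :: 'p mod_ring vec. monom (monom (1 :: int) (N - hamming_weight c)) (hamming_weight c)"
  have "weight_enumerator N (gray ` D) = (\<Sum>y\<in>D. ?g (gray y))"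
    unfolding weight_enumerator_def
    by (simp add: sum.reindex[OF inj_on_subset[OF gray_injective sub(2)]])
  also have "\<dots> = (\<Sum>x\<in>C. ?g (gray (T x)))"
    by (rule sum.reindex_bij_betw[OF bij, symmetric])
  also have "\<dots> = (\<Sum>x\<in>C. ?g (gray x))"
    using sub wt by (intro sum.cong refl) (simp add: subset_eq)
  also have "\<dots> = weight_enumerator N (gray ` C)"
    unfolding weight_enumerator_def
    by (simp add: sum.reindex[OF inj_on_subset[OF gray_injective sub(1)]])
  finally show ?thesis by simp
qed

end


section \<open>Quadratic residues\<close>

lemma Legendre_values: "Legendre a p = 0 \<or> Legendre a p = 1 \<or> Legendre a p = - 1"
  by (simp add: Legendre_def)

lemma Legendre_cong:
  assumes "[a = b] (mod p)"
  shows "Legendre a p = Legendre b p"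
proof -
  have "[a = 0] (mod p) \<longleftrightarrow> [b = 0] (mod p)"
    using assms by (meson cong_sym cong_trans)
  moreover have "QuadRes p a \<longleftrightarrow> QuadRes p b"
    unfolding QuadRes_def using assms by (meson cong_sym cong_trans)
  ultimately show ?thesis by (simp add: Legendre_def)
qed

lemma sign_cong_imp_eq:
  fixes x y :: int
  assumes "[x = y] (mod p)" "2 < p" "x \<in> {-1, 0, 1}" "y \<in> {-1, 0, 1}"
  shows "x = y"
proof -
  have "p dvd x - y" using assms(1) by (simp add: cong_iff_dvd_diff)
  moreover have "\<bar>x - y\<bar> < p" using assms(2-) by auto
  ultimately show ?thesis using zdvd_imp_le[of p "\<bar>x - y\<bar>"] by fastforce
qed

context
  fixes q :: nat
  assumes q: "prime q" "odd q"
begin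

lemma q_gr_2: "2 < q"
  using q prime_ge_2_nat[of q] by (cases "q = 2") auto

lemma Legendre_mult: "Legendre (a * b) q = Legendre a q * Legendre b q"
proof (rule sign_cong_imp_eq)
  have "[Legendre (a * b) q = (a * b) ^ ((q - 1) div 2)] (mod q)"
    using euler_criterion q q_gr_2 by blast
  also have "(a * b) ^ ((q - 1) div 2) = a ^ ((q - 1) div 2) * b ^ ((q - 1) div 2)"
    by (rule power_mult_distrib)
  also have "[\<dots> = Legendre a q * Legendre b q] (mod q)"
    using euler_criterion q q_gr_2 by (intro cong_mult) (blast intro: cong_sym)+
  finally show "[Legendre (a * b) q = Legendre a q * Legendre b q] (mod q)" .
  show "Legendre a q * Legendre b q \<in> {-1, 0, 1}"
    using Legendre_values[of a q] Legendre_values[of b q] by auto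
qed (use Legendre_values[of "a * b" q] q_gr_2 in auto)

lemma Legendre_minus_1: "Legendre (- 1) q = (- 1) ^ ((q - 1) div 2)"
proof (rule sign_cong_imp_eq)
  show "[Legendre (- 1) q = (- 1) ^ ((q - 1) div 2)] (mod q)"
    using euler_criterion q q_gr_2 by blast
  show "(- 1 :: int) ^ ((q - 1) div 2) \<in> {-1, 0, 1}"
    by (cases "even ((q - 1) div 2)") auto
qed (use Legendre_values[of "- 1" q] q_gr_2 in auto)

lemma not_cong_0: "i \<in> {1..<q} \<Longrightarrow> \<not> [int i = 0] (mod int q)"
  by (auto simp: cong_0_iff dest: zdvd_imp_le)

lemma quad_residues_Legendre:
  assumes "i \<in> {1..<q}"
  shows "i \<in> quad_residues q \<longleftrightarrow> Legendre i q = 1"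
  using assms not_cong_0[OF assms] by (auto simp: quad_residues_def Legendre_def)

lemma quad_nonresidues_eq: "quad_nonresidues q = {1..<q} - quad_residues q"
  by (auto simp: quad_nonresidues_def quad_residues_def)

lemma quad_residues_reflect:
  assumes i: "i \<in> {1..<q}"
  shows "q mod 4 = 1 \<Longrightarrow> q - i \<in> quad_residues q \<longleftrightarrow> i \<in> quad_residues q"
    and "q mod 4 = 3 \<Longrightarrow> q - i \<in> quad_residues q \<longleftrightarrow> i \<notin> quad_residues q"
proof -
  have i': "q - i \<in> {1..<q}" using i by auto
  have "[int (q - i) = - 1 * int i] (mod int q)"
    using i by (simp add: cong_iff_dvd_diff of_nat_diff)
  then have L: "Legendre (int (q - i)) q = (- 1) ^ ((q - 1) div 2) * Legendre i q"
    using Legendre_cong Legendre_mult Legendre_minus_1 by metis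
  have nz: "Legendre (int i) q = 1 \<or> Legendre (int i) q = - 1"
    using not_cong_0[OF i] by (auto simp: Legendre_def)
  {
    assume "q mod 4 = 1"
    then have "even ((q - 1) div 2)" by presburger
    then show "q - i \<in> quad_residues q \<longleftrightarrow> i \<in> quad_residues q"
      using L by (simp add: quad_residues_Legendre[OF i] quad_residues_Legendre[OF i'])
  next
    assume "q mod 4 = 3"
    then have "odd ((q - 1) div 2)" by presburger
    then show "q - i \<in> quad_residues q \<longleftrightarrow> i \<notin> quad_residues q"
      using L nz by (auto simp: quad_residues_Legendre[OF i] quad_residues_Legendre[OF i'])
  }
qed

lemma mod_mem_range:
  assumes "c \<in> {1..<q}" "i \<in> {1..<q}"
  shows "c * i mod q \<in> {1..<q}"
proof -
  have "\<not> q dvd c" "\<not> q dvd i" using assms by (auto dest: dvd_imp_le)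
  then have "\<not> q dvd c * i" using q(1) by (simp add: prime_dvd_mult_iff)
  then have "0 < c * i mod q" by (simp add: mod_greater_zero_iff_not_dvd)
  then show ?thesis using q_gr_2 by simp
qed

lemma quad_residues_times_nonresidue:
  assumes c: "c \<in> quad_nonresidues q" and i: "i \<in> {1..<q}"
  shows "c * i mod q \<in> quad_residues q \<longleftrightarrow> i \<notin> quad_residues q"
proof -
  have c': "c \<in> {1..<q}" "\<not> QuadRes q c" using c by (auto simp: quad_nonresidues_def)
  then have Lc: "Legendre c q = - 1" using not_cong_0 by (simp add: Legendre_def)
  have "[int (c * i mod q) = int c * int i] (mod int q)"
    by (simp add: of_nat_mod cong_def)
  then have L: "Legendre (int (c * i mod q)) q = - Legendre i q"
    using Legendre_cong Legendre_mult Lc by (metis mult_minus1)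
  have nz: "Legendre (int i) q = 1 \<or> Legendre (int i) q = - 1"
    using not_cong_0[OF i] by (auto simp: Legendre_def)
  show ?thesis
    using L nz by (auto simp: quad_residues_Legendre[OF i] quad_residues_Legendre[OF mod_mem_range[OF c'(1) i]])
qed

text \<open>Squaring modulo \<open>q\<close> identifies \<open>1\<close> and \<open>q - 1\<close>, so that it misses some unit.\<close>

lemma nonresidue_exists: obtains c where "c \<in> quad_nonresidues q"
proof -
  let ?A = "{1..<q}" and ?s = "\<lambda>y. y * y mod q"
  have "quad_nonresidues q \<noteq> {}"
  proof
    assume "quad_nonresidues q = {}"
    then have all: "QuadRes q i" if "i \<in> ?A" for i
      using that by (auto simp: quad_nonresidues_def)
    have "?A \<subseteq> ?s ` ?A"
    proof
      fix i assume i: "i \<in> ?A"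
      then obtain y where y: "[y\<^sup>2 = int i] (mod int q)" using all by (auto simp: QuadRes_def)
      define z where "z = nat (y mod int q)"
      have z: "int z = y mod int q" using q_gr_2 by (simp add: z_def)
      have "int (?s z) = y\<^sup>2 mod int q"
        by (simp add: of_nat_mod z mod_mult_eq power2_eq_square)
      also have "\<dots> = int i" using y i by (simp add: cong_def)
      finally have s: "?s z = i" by simp
      have "z \<noteq> 0" using s i by (intro notI) simp
      moreover have "z < q" using z q_gr_2 by (metis of_nat_less_iff pos_mod_bound of_nat_0_less_iff gr0I less_nat_zero_code)
      ultimately show "i \<in> ?s ` ?A" using s by (intro image_eqI[of _ _ z]) auto
    qed
    then have "inj_on ?s ?A"
      by (intro finite_surj_inj) auto
    moreover have "?s 1 = ?s (q - 1)"
    proof -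
      have "(q - 1) * (q - 1) = 1 + q * (q - 2)"
        using q_gr_2 by (cases q; cases "q - 1") (auto simp: algebra_simps)
      then show ?thesis using q_gr_2 by (metis mod_mult_self2 mult_1)
    qed
    ultimately have "1 = q - 1" by (rule inj_onD) (use q_gr_2 in auto)
    then show False using q_gr_2 by simp
  qed
  then show thesis using that by blast
qed

end

section \<open>Roots of unity in prime fields\<close>

lemma primitive_element_order:
  fixes \<alpha> :: "'p::prime_card mod_ring"
  assumes "primitive_element \<alpha>"
  shows "primitive_root_of_unity (CARD('p) - 1) \<alpha>"
proof -
  let ?p = "CARD('p)"
  have range: "range (\<lambda>k::nat. \<alpha> ^ k) = UNIV - {0}"
    using assms by (auto simp: primitive_element_def)
  have card: "card (UNIV - {0 :: 'p mod_ring}) = ?p - 1"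
    by (simp add: card_Diff_singleton)
  have p: "?p \<ge> 2" using prime_card[where 'a = 'p] by (rule prime_ge_2_nat)
  have nz: "\<alpha> \<noteq> 0" using range by (metis Diff_iff UNIV_I insertI1 power_one_right rangeI)
  have no: "\<alpha> ^ k \<noteq> 1" if "0 < k" "k < ?p - 1" for k
  proof
    assume *: "\<alpha> ^ k = 1"
    have "\<alpha> ^ j = \<alpha> ^ (j mod k)" for j
    proof -
      have "\<alpha> ^ j = \<alpha> ^ (k * (j div k) + j mod k)" by simp
      also have "\<dots> = \<alpha> ^ (j mod k)" unfolding power_add power_mult * by simp
      finally show ?thesis .
    qed
    then have "range (\<lambda>k::nat. \<alpha> ^ k) \<subseteq> (\<lambda>j. \<alpha> ^ j) ` {..<k}"
      using that(1) by (auto intro: image_eqI[where x = "_ mod k"])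
    then have "?p - 1 \<le> card ((\<lambda>j. \<alpha> ^ j) ` {..<k})"
      unfolding card[symmetric] range by (rule card_mono[rotated]) simp
    also have "\<dots> \<le> k" using card_image_le[of "{..<k}"] by simp
    finally show False using that by simp
  qed
  have "\<not> inj_on (\<lambda>j. \<alpha> ^ j) {..<?p}"
  proof
    assume "inj_on (\<lambda>j. \<alpha> ^ j) {..<?p}"
    then have "?p = card ((\<lambda>j. \<alpha> ^ j) ` {..<?p})" by (simp add: card_image)
    also have "\<dots> \<le> ?p - 1"
      unfolding card[symmetric] by (rule card_mono) (use nz in auto)
    finally show False using p by simp
  qed
  then obtain i j where ij: "i < j" "j < ?p" "\<alpha> ^ i = \<alpha> ^ j"
    unfolding inj_on_def by (metis lessThan_iff linorder_neqE_nat)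
  have "\<alpha> ^ i * \<alpha> ^ (j - i) = \<alpha> ^ i * 1"
    unfolding power_add[symmetric] using ij by simp
  then have "\<alpha> ^ (j - i) = 1" using nz by simp
  moreover from this have "j - i = ?p - 1"
    using no[of "j - i"] ij by (metis One_nat_def Suc_leI diff_le_self le_neq_implies_less less_imp_diff_less less_Suc_eq_le Suc_pred' zero_less_diff zero_less_card_finite)
  ultimately have "\<alpha> ^ (?p - 1) = 1" by simp
  then show ?thesis using no by (simp add: primitive_root_of_unity_def)
qed

lemma primitive_root_power:
  assumes "primitive_root_of_unity (d * n) \<alpha>" "0 < d"
  shows "primitive_root_of_unity n (\<alpha> ^ d)"
  using assms by (auto simp: primitive_root_of_unity_def simp flip: power_mult)

section \<open>Extended quadratic residue codes over the ring\<close>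

context cyclic_zeros
begin

lemma linear_even_code: "linear_code q (even_code Z)"
proof -
  have "spectrum (($) (x + y)) i = spectrum (($) x) i + spectrum (($) y) i"
    if "y \<in> carrier_vec q" for x y i
    unfolding spectrum_add[symmetric] using that by (intro spectrum_cong) simp
  moreover have "spectrum (($) (c \<cdot>\<^sub>v x)) i = emb c * spectrum (($) x) i"
    if "x \<in> carrier_vec q" for x c i
    unfolding spectrum_scale[symmetric] using that by (intro spectrum_cong) simp
  moreover have "spectrum (($) (0\<^sub>v q)) i = 0" for i
    unfolding spectrum_zero[of i, symmetric] by (intro spectrum_cong) simp
  ultimately show ?thesis
    unfolding linear_code_iff even_code_def by auto
qed

lemma linear_ext_code: "linear_code (Suc q) (ext_code Z a b)"
proof -
  have "spectrum (\<lambda>t. (x + y) $ Suc t) i = spectrum (\<lambda>t. x $ Suc t) i + spectrum (\<lambda>t. y $ Suc t) i"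
    if "y \<in> carrier_vec (Suc q)" for x y i
    unfolding spectrum_add[symmetric] using that by (intro spectrum_cong) simp
  moreover have "spectrum (\<lambda>t. (c \<cdot>\<^sub>v x) $ Suc t) i = emb c * spectrum (\<lambda>t. x $ Suc t) i"
    if "x \<in> carrier_vec (Suc q)" for x c i
    unfolding spectrum_scale[symmetric] using that by (intro spectrum_cong) simp
  moreover have "spectrum (\<lambda>t. 0\<^sub>v (Suc q) $ Suc t) i = 0" for i
    unfolding spectrum_zero[of i, symmetric] by (intro spectrum_cong) simp
  moreover have "(\<Sum>t<q. (x + y) $ Suc t) = (\<Sum>t<q. x $ Suc t) + (\<Sum>t<q. y $ Suc t)"
    if "y \<in> carrier_vec (Suc q)" for x y :: "'f vec"
    unfolding sum.distrib[symmetric] using that by (intro sum.cong) auto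
  moreover have "(\<Sum>t<q. (c \<cdot>\<^sub>v x) $ Suc t) = c * (\<Sum>t<q. x $ Suc t)"
    if "x \<in> carrier_vec (Suc q)" for x :: "'f vec" and c
    unfolding sum_distrib_left using that by (intro sum.cong) auto
  ultimately show ?thesis
    unfolding linear_code_iff ext_code_def by (auto simp: distrib_left mult.left_commute[of a])
qed

end

text \<open>The Gray map of \<open>\<R>\<close> together with an extension field of \<open>F\<^sub>p\<close> that contains the \<open>q\<close>-th roots of
  unity.\<close>

locale qr_setting =
  G: gray_isometry \<xi> m ring_type V lam + Z: cyclic_zeros emb \<zeta> q
  for \<xi> :: "'p::prime_card mod_ring" and m :: nat and ring_type :: "'m::finite itself"
    and V :: "'p mod_ring mat" and lam :: "'p mod_ring"
    and emb :: "'p mod_ring \<Rightarrow> 'k::field" and \<zeta> :: 'k and q :: nat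
begin

text \<open>For the zeros \<open>Z1\<close> and \<open>Z2\<close> given by the residues and the non-residues this describes the
  even-like code \<open>S\<^sub>I\<close>.\<close>

lemma qr_code_components:
  fixes e1 e2 :: "('p mod_ring, 'n::finite) cyclic_ring"
  assumes n: "CARD('n) = q" and I: "I \<subseteq> {1..m}"
    and g: "Z.zeros_poly Z1 g1" "Z.zeros_poly Z2 g2"
    and e1: "idempotent_generator e1 (principal_ideal (cyclic_ring_of_poly g1))"
    and e2: "idempotent_generator e2 (principal_ideal (cyclic_ring_of_poly g2))"
  shows "qr_code \<xi> I e1 e2 =
    G.component_code q (\<lambda>i. Z.even_code (if G.ev i (eta_set \<xi> I) = 1 then Z1 else Z2))"
proof -
  let ?\<eta> = "eta_set \<xi> I :: ('p, 'm) gray_ring"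
  interpret EP: map_poly_comm_ring_hom "G.ev i" for i ..
  have *: "(if G.ev i ?\<eta> = 1 then e1 else e2) dvd cyclic_ring_of_poly (map_poly (G.ev i) (\<Sum>t<q. monom (c $ t) t))
     \<longleftrightarrow> map_vec (G.ev i) c \<in> Z.even_code (if G.ev i ?\<eta> = 1 then Z1 else Z2)"
    if c: "c \<in> carrier_vec q" for c i
  proof -
    define v where "v = map_vec (G.ev i) c"
    have "map_poly (G.ev i) (\<Sum>t<q. monom (c $ t) t) = (\<Sum>t<q. monom (v $ t) t)"
      using c unfolding EP.hom_sum v_def by (intro sum.cong) auto
    moreover have "v \<in> carrier_vec q" using c by (simp add: v_def)
    moreover have "a dvd x \<longleftrightarrow> x \<in> principal_ideal (cyclic_ring_of_poly h)"
      if "idempotent_generator a (principal_ideal (cyclic_ring_of_poly h))"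
      for a x :: "('p mod_ring, 'n) cyclic_ring" and h
      using that by (auto simp: idempotent_generator_def principal_ideal_def)
    ultimately show ?thesis
      using e1 e2 Z.generated_iff_zeros[OF g(1) n] Z.generated_iff_zeros[OF g(2) n]
      unfolding v_def[symmetric] by (simp add: Z.even_code_def)
  qed
  have idem: "e1 * e1 = e1" "e2 * e2 = e2"
    using e1 e2 by (simp_all add: idempotent_generator_def)
  have "c \<in> qr_code \<xi> I e1 e2 \<longleftrightarrow> c \<in> carrier_vec q \<and>
      idempotent_mix ?\<eta> e1 e2 dvd cyclic_ring_of_poly (\<Sum>t<q. monom (c $ t) t)" for c
    by (simp add: qr_code_def coeff_vectors_def principal_ideal_def n)
  then show ?thesis
    unfolding G.idempotent_mix_dvd_iff[OF idem G.ev_eta_set[OF I]] G.component_code_def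
    using * by blast
qed

text \<open>The extended code, defined as a span over the ring, is cut out componentwise by the equations
  of \<open>ext_code\<close>; this holds for every \<open>r\<close>.\<close>

lemma extended_code_components:
  assumes Z: "\<And>i. Z i \<subseteq> {1..<q}"
    and S: "S = G.component_code q (\<lambda>i. Z.even_code (Z i))"
  shows "extended_code q r S = G.component_code (Suc q) (\<lambda>i. Z.ext_code (Z i) r (of_nat q))"
    (is "_ = ?E")
proof
  let ?one = "vCons (gray_ring_const r) (vec q (\<lambda>_. 1)) :: ('p, 'm) gray_ring vec"
  let ?gens = "vCons 0 ` S \<union> {?one}"
  have gens: "?gens \<subseteq> carrier_vec (q + 1)"
    by (auto simp: S G.component_code_def)
  have lin: "linear_code (q + 1) ?E"
    using G.linear_component_code[OF Z.linear_ext_code] by simp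
  have vCons0: "map_vec (G.ev i) (vCons 0 g) \<in> Z.ext_code (Z i) r (of_nat q)"
    if g: "g \<in> carrier_vec q" "map_vec (G.ev i) g \<in> Z.even_code (Z i)" for g i
  proof -
    have eq: "map_vec (G.ev i) (vCons 0 g) $ Suc t = map_vec (G.ev i) g $ t" if "t < q" for t
      using g that by simp
    have "Z.spectrum (\<lambda>t. map_vec (G.ev i) (vCons 0 g) $ Suc t) j = Z.spectrum (($) (map_vec (G.ev i) g)) j" for j
      by (rule Z.spectrum_cong) (rule eq)
    moreover have "(\<Sum>t<q. map_vec (G.ev i) (vCons 0 g) $ Suc t) = (\<Sum>t<q. map_vec (G.ev i) g $ t)"
      by (rule sum.cong) (simp_all only: eq lessThan_iff)
    ultimately show ?thesis
      using g Z.spectrum_0_eq_0_iff[of "($) (map_vec (G.ev i) g)"]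
      by (simp add: Z.ext_code_def Z.even_code_def)
  qed
  have one: "map_vec (G.ev i) ?one \<in> Z.ext_code (Z i) r (of_nat q)" for i
  proof -
    have "Z.spectrum (\<lambda>t. map_vec (G.ev i) ?one $ Suc t) j = 0" if "j \<in> Z i" for j
    proof -
      have "Z.spectrum (\<lambda>t. map_vec (G.ev i) ?one $ Suc t) j = Z.spectrum (\<lambda>_. 1) j"
        by (rule Z.spectrum_cong) simp
      then show ?thesis using Z.spectrum_const[of j 1] that Z[of i] by auto
    qed
    then show ?thesis by (simp add: Z.ext_code_def mult.commute)
  qed
  show "extended_code q r S \<subseteq> ?E"
    unfolding extended_code_def
    by (rule linear_code_span(3)[OF gens lin])
      (use vCons0 one in \<open>auto simp: S G.component_code_def\<close>)
  show "?E \<subseteq> extended_code q r S"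
  proof
    fix x assume x: "x \<in> ?E"
    then have dim: "x \<in> carrier_vec (Suc q)" by (simp add: G.component_code_def)
    \<comment> \<open>Split off the multiple of \<open>(r, 1, \<dots>, 1)\<close> given by the average of the cyclic part.\<close>
    define a where "a = gray_ring_const (inverse (of_nat q)) * (\<Sum>t<q. x $ Suc t)"
    define g where "g = vec q (\<lambda>t. x $ Suc t - a)"
    have eva: "of_nat q * G.ev i a = (\<Sum>t<q. G.ev i (x $ Suc t))" for i
      using Z.q_unit_base by (simp add: a_def G.ev.hom_mult G.ev.hom_sum flip: mult.assoc)
    have comp: "r * (\<Sum>t<q. G.ev i (x $ Suc t)) = of_nat q * G.ev i (x $ 0)"
      "\<And>j. j \<in> Z i \<Longrightarrow> Z.spectrum (\<lambda>t. G.ev i (x $ Suc t)) j = 0" if "i < m" for i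
    proof -
      have *: "map_vec (G.ev i) x \<in> Z.ext_code (Z i) r (of_nat q)"
        using x that by (simp add: G.component_code_def)
      moreover have "Z.spectrum (\<lambda>t. map_vec (G.ev i) x $ Suc t) j = Z.spectrum (\<lambda>t. G.ev i (x $ Suc t)) j" for j
        using dim by (intro Z.spectrum_cong) simp
      ultimately show "\<And>j. j \<in> Z i \<Longrightarrow> Z.spectrum (\<lambda>t. G.ev i (x $ Suc t)) j = 0"
        by (simp add: Z.ext_code_def)
      show "r * (\<Sum>t<q. G.ev i (x $ Suc t)) = of_nat q * G.ev i (x $ 0)"
        using * dim by (simp add: Z.ext_code_def)
    qed
    have x0: "x $ 0 = a * gray_ring_const r"
    proof (rule G.ev_injective)
      fix i assume i: "i < m"
      have "of_nat q * G.ev i (x $ 0) = of_nat q * G.ev i (a * gray_ring_const r)"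
        using comp(1)[OF i] eva[of i] by (simp add: G.ev.hom_mult mult_ac)
      then show "G.ev i (x $ 0) = G.ev i (a * gray_ring_const r)"
        using Z.q_unit_base by simp
    qed
    have "map_vec (G.ev i) g \<in> Z.even_code (Z i)" if i: "i < m" for i
    proof -
      have spec: "Z.spectrum (($) (map_vec (G.ev i) g)) j
          = Z.spectrum (\<lambda>t. G.ev i (x $ Suc t)) j + Z.spectrum (\<lambda>_. - G.ev i a) j" for j
        unfolding Z.spectrum_add[symmetric]
        by (rule Z.spectrum_cong) (simp add: g_def G.ev.hom_minus)
      have "Z.spectrum (($) (map_vec (G.ev i) g)) 0 = 0"
        unfolding Z.spectrum_0_eq_0_iff using eva[of i]
        by (simp add: g_def G.ev.hom_minus sum_subtractf)
      moreover have "Z.spectrum (($) (map_vec (G.ev i) g)) j = 0" if "j \<in> Z i" for j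
        using that Z[of i] comp(2)[OF i that] Z.spectrum_const[of j "- G.ev i a"] by (auto simp: spec)
      ultimately show ?thesis by (simp add: Z.even_code_def g_def)
    qed
    then have g: "g \<in> S" by (simp add: S G.component_code_def g_def)
    have "x = a \<cdot>\<^sub>v ?one + vCons 0 g"
    proof (rule eq_vecI)
      fix t assume "t < dim_vec (a \<cdot>\<^sub>v ?one + vCons 0 g)"
      then show "x $ t = (a \<cdot>\<^sub>v ?one + vCons 0 g) $ t"
        by (cases t) (auto simp: x0 g_def)
    qed (use dim in \<open>simp add: g_def\<close>)
    moreover have "a \<cdot>\<^sub>v ?one + vCons 0 g \<in> code_span (q + 1) ?gens"
      using linear_code_span(1,2)[OF gens] g unfolding linear_code_iff by (auto simp: subset_eq)
    ultimately show "x \<in> extended_code q r S"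
      by (simp only: extended_code_def)
  qed
qed

lemma self_dual_components:
  assumes "\<And>i. i < m \<Longrightarrow> linear_code n (C i)" "\<And>i. i < m \<Longrightarrow> dual_code n (C i) = C i"
  shows "self_dual (m * n) (G.gray ` G.component_code n C)"
proof -
  have "G.component_code n (\<lambda>i. dual_code n (C i)) = G.component_code n C"
    using assms(2) by (simp add: G.component_code_def)
  then show ?thesis
    using assms G.dual_gray_code[of C n] unfolding self_dual_def
    by (simp add: G.linear_gray_code G.linear_component_code linear_code_iff[of n "C _"])
qed

lemma self_orthogonal_components:
  assumes "\<And>i. i < m \<Longrightarrow> linear_code n (C i)" "\<And>i. i < m \<Longrightarrow> C i \<subseteq> dual_code n (C i)"
  shows "self_orthogonal (m * n) (G.gray ` G.component_code n C)"
proof -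
  have "G.component_code n C \<subseteq> G.component_code n (\<lambda>i. dual_code n (C i))"
    using assms(2) by (auto simp: G.component_code_def)
  then show ?thesis
    using assms G.dual_gray_code[of C n] unfolding self_orthogonal_def
    by (simp add: G.linear_gray_code G.linear_component_code linear_code_iff[of n "C _"] image_mono)
qed

text \<open>The coordinate at infinity is scaled by \<open>-q\<close> and the positions of the cyclic coordinates are
  multiplied by \<open>c\<close>, simultaneously in all components. The hypothesis on \<open>c\<close> says that this carries
  the zeros of each component to those of its dual.\<close>

lemma formally_self_dual_components:
  assumes c: "coprime c q" and g: "\<And>i. i < m \<Longrightarrow> Z.zeros_poly (Z i) (g i)"
    and Z: "\<And>i j. i < m \<Longrightarrow> j \<in> {1..<q} \<Longrightarrow> q - (c * j mod q) \<notin> Z i \<longleftrightarrow> j \<in> Z i"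
  shows "formally_self_dual (m * Suc q) (G.gray ` G.component_code (Suc q) (\<lambda>i. Z.ext_code (Z i) 1 (of_nat q)))"
proof -
  let ?C = "\<lambda>i. Z.ext_code (Z i) 1 (of_nat q)"
  define Z' where "Z' i = {j \<in> {1..<q}. q - j \<notin> Z i}" for i
  let ?D = "\<lambda>i. Z.ext_code (Z' i) 1 (- 1)"
  define d :: "nat \<Rightarrow> 'p mod_ring" where "d t = (if t = 0 then - of_nat q else 1)" for t
  define \<pi> where "\<pi> t = (if t = 0 then 0 else Suc (c * (t - 1) mod q))" for t
  have D: "G.component_code (Suc q) (\<lambda>i. dual_code (Suc q) (?C i)) = G.component_code (Suc q) ?D"
    using Z.dual_ext_code[OF g] by (simp add: G.component_code_def Z'_def)
  have "inj_on \<pi> {..<Suc q}"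
  proof (rule inj_onI)
    fix s t assume st: "s \<in> {..<Suc q}" "t \<in> {..<Suc q}" "\<pi> s = \<pi> t"
    show "s = t"
    proof (cases "s = 0 \<or> t = 0")
      case False
      then have "[c * (s - 1) = c * (t - 1)] (mod q)" using st by (simp add: \<pi>_def cong_def)
      then have "[s - 1 = t - 1] (mod q)" using c by (simp add: cong_mult_lcancel_nat)
      then have "s - 1 = t - 1"
        by (rule cong_less_modulus_unique_nat) (use False st in auto)
      then show ?thesis using False by arith
    qed (use st in \<open>auto simp: \<pi>_def split: if_splits\<close>)
  qed
  then have \<pi>: "bij_betw \<pi> {..<Suc q} {..<Suc q}"
    by (intro bij_betw_imageI endo_inj_surj) (use Z.q_pos in \<open>auto simp: \<pi>_def\<close>)
  have "weight_enumerator (m * Suc q) (G.gray ` G.component_code (Suc q) ?C)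
      = weight_enumerator (m * Suc q) (G.gray ` G.component_code (Suc q) ?D)"
  proof (rule G.weight_enumerator_monomial[OF \<pi>])
    show "d t \<noteq> 0" for t using Z.q_unit_base by (simp add: d_def)
    fix x :: "('p, 'm) gray_ring vec" assume x: "x \<in> carrier_vec (Suc q)"
    have "map_vec (G.ev i) (vec (Suc q) (\<lambda>t. gray_ring_const (d t) * x $ \<pi> t)) \<in> ?D i
        \<longleftrightarrow> map_vec (G.ev i) x \<in> ?C i" if i: "i < m" for i
    proof -
      have "map_vec (G.ev i) (vec (Suc q) (\<lambda>t. gray_ring_const (d t) * x $ \<pi> t))
          = vec (Suc q) (\<lambda>t. if t = 0 then - of_nat q * map_vec (G.ev i) x $ 0
              else map_vec (G.ev i) x $ Suc (c * (t - 1) mod q))"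
        using x Z.q_pos by (intro eq_vecI) (auto simp: d_def \<pi>_def G.ev.hom_mult)
      also have "\<dots> \<in> ?D i \<longleftrightarrow> map_vec (G.ev i) x \<in> ?C i"
      proof (rule Z.ext_code_monomial[OF c])
        fix j assume j: "j \<in> {1..<q}"
        have "c * j mod q \<noteq> 0"
        proof
          assume "c * j mod q = 0"
          then have "q dvd c * j" by (simp add: mod_eq_0_iff_dvd)
          then have "q dvd j" using c by (simp add: coprime_dvd_mult_right_iff coprime_commute)
          then show False using j by (auto dest: dvd_imp_le)
        qed
        then show "c * j mod q \<in> Z' i \<longleftrightarrow> j \<in> Z i"
          using Z[OF i j] Z.q_pos by (simp add: Z'_def)
      qed (use g[OF i] x in \<open>auto simp: Z'_def Z.zeros_poly_def\<close>)
      finally show ?thesis .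
    qed
    then show "vec (Suc q) (\<lambda>t. gray_ring_const (d t) * x $ \<pi> t) \<in> G.component_code (Suc q) ?D
        \<longleftrightarrow> x \<in> G.component_code (Suc q) ?C"
      using x by (simp add: G.component_code_def)
  qed (auto simp: G.component_code_def)
  moreover have "dual_code (m * Suc q) (G.gray ` G.component_code (Suc q) ?C)
      = G.gray ` G.component_code (Suc q) ?D"
    unfolding D[symmetric] using Z.linear_ext_code by (intro G.dual_gray_code) (simp add: linear_code_iff)
  moreover have "linear_code (m * Suc q) (G.gray ` G.component_code (Suc q) ?C)"
    by (intro G.linear_gray_code G.linear_component_code Z.linear_ext_code)
  ultimately show ?thesis by (simp only: formally_self_dual_def)
qed

end


theorem mainTheorem8:
  fixes m p q :: nat
    and V :: "'p::prime_card mod_ring mat"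
    and lam \<alpha> \<xi> :: "'p mod_ring"
    and emb :: "'p mod_ring \<Rightarrow> 'k::field"
    and \<zeta> :: 'k
    and rpoly npoly :: "'p mod_ring poly"
    and e1 e2 :: "('p mod_ring, 'q::finite) cyclic_ring"
    and I :: "nat set"
    and S :: "('p, 'm::finite) gray_ring vec set"
  assumes card_m: "CARD('m) = m" and card_p: "CARD('p) = p" and card_q: "CARD('q) = q"
    and m: "m \<ge> 2"
    and p: "prime p" "[p = 1] (mod (m - 1))"
    and q: "prime q" "odd q"
    and pq: "\<not> q dvd p" "QuadRes (int q) (int p)"
    and V: "V \<in> carrier_mat m m" "lam \<noteq> 0" "V * transpose_mat V = lam \<cdot>\<^sub>m 1\<^sub>m m"
    and \<xi>: "primitive_element \<alpha>" "\<xi> = \<alpha> ^ ((p - 1) div (m - 1))"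
    and emb: "field_hom emb"
    and \<zeta>: "primitive_root_of_unity q \<zeta>"
    and rpoly: "map_poly emb rpoly = (\<Prod>i\<in>quad_residues q. [:- (\<zeta> ^ i), 1:])"
    and npoly: "map_poly emb npoly = (\<Prod>i\<in>quad_nonresidues q. [:- (\<zeta> ^ i), 1:])"
    and e1: "idempotent_generator e1 (principal_ideal (cyclic_ring_of_poly ([:-1, 1:] * rpoly)))"
    and e2: "idempotent_generator e2 (principal_ideal (cyclic_ring_of_poly ([:-1, 1:] * npoly)))"
    and I: "I \<noteq> {}" "I \<subseteq> {1..m}"
    and S: "S = qr_code \<xi> I e1 e2"
  shows "(q mod 4 = 3 \<longrightarrow>
            (\<forall>r. r ^ 2 = - of_nat q \<longrightarrow>
               self_dual (m * (q + 1)) (gray_map_vec V \<xi> ` extended_code q r S)) \<and>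
            self_orthogonal (m * q) (gray_map_vec V \<xi> ` S)) \<and>
         (q mod 4 = 1 \<longrightarrow>
            formally_self_dual (m * (q + 1)) (gray_map_vec V \<xi> ` extended_code q 1 S))"
proof -
  have q0: "of_nat q \<noteq> (0 :: 'p mod_ring)"
  proof
    assume "of_nat q = (0 :: 'p mod_ring)"
    then have "p dvd q" using of_nat_0_mod_ring_dvd card_p by blast
    then have "p = q" by (rule primes_dvd_imp_eq[OF p(1) q(1)])
    then show False using pq(1) by simp
  qed
  interpret E: field_hom emb by (rule emb)
  have "emb (of_nat q) \<noteq> 0" using q0 E.hom_0_iff by blast
  then have q0': "of_nat q \<noteq> (0 :: 'k)" by (simp add: E.hom_of_nat)

  \<comment> \<open>\<open>\<xi>\<close> has order \<open>m - 1\<close>, a divisor of \<open>p - 1\<close>, so that \<open>m - 1\<close> is invertible.\<close>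
  have "(m - 1) dvd p - 1"
    using p prime_ge_2_nat[of p] by (simp add: cong_altdef_nat cong_sym_eq)
  then have pm: "p - 1 = (p - 1) div (m - 1) * (m - 1)" by simp
  moreover have "0 < p - 1" using p(1) prime_ge_2_nat[of p] by simp
  ultimately have div_pos: "0 < (p - 1) div (m - 1)" by (metis gr0I mult_is_0)
  have "primitive_root_of_unity ((p - 1) div (m - 1) * (m - 1)) \<alpha>"
    using primitive_element_order[OF \<xi>(1)] pm card_p by simp
  then have \<xi>_order: "primitive_root_of_unity (m - 1) \<xi>"
    unfolding \<xi>(2) using div_pos by (rule primitive_root_power)
  have "of_nat (m - 1) \<noteq> (0 :: 'p mod_ring)"
  proof
    assume "of_nat (m - 1) = (0 :: 'p mod_ring)"
    then have "p dvd m - 1" using of_nat_0_mod_ring_dvd card_p by blast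
    then have "p \<le> m - 1" using m by (simp add: dvd_imp_le)
    moreover have "m - 1 \<le> p - 1" using \<open>(m - 1) dvd p - 1\<close> \<open>0 < p - 1\<close> by (rule dvd_imp_le)
    ultimately show False using \<open>0 < p - 1\<close> by simp
  qed
  then interpret qr_setting \<xi> m "TYPE('m)" V lam emb \<zeta> q
    using \<xi>_order \<zeta> q0' m V card_m prime_gt_0_nat[OF q(1)] by unfold_locales simp_all

  let ?Q = "quad_residues q" and ?N = "quad_nonresidues q"
  have N: "?N = {1..<q} - ?Q" by (rule quad_nonresidues_eq[OF q])
  have sub: "?Q \<subseteq> {1..<q}" "?N \<subseteq> {1..<q}" by (auto simp: quad_residues_def N)
  have zQ: "Z.zeros_poly ?Q ([:-1, 1:] * rpoly)"
    by (rule Z.zeros_poly_mult[OF sub(1) rpoly])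
  have zN: "Z.zeros_poly ?N ([:-1, 1:] * npoly)"
    by (rule Z.zeros_poly_mult[OF sub(2) npoly])
  define Z where "Z i = (if G.ev i (eta_set \<xi> I) = 1 then ?Q else ?N)" for i
  define g where "g i = (if G.ev i (eta_set \<xi> I) = 1 then [:-1, 1:] * rpoly else [:-1, 1:] * npoly)" for i
  have zg: "Z.zeros_poly (Z i) (g i)" for i using zQ zN by (simp add: Z_def g_def)
  have Z_sub: "Z i \<subseteq> {1..<q}" for i using sub by (simp add: Z_def)
  have S_comp: "S = G.component_code q (\<lambda>i. Z.even_code (Z i))"
    unfolding S Z_def by (rule qr_code_components[OF card_q I(2) zQ zN e1 e2])
  have ext: "extended_code q r S = G.component_code (Suc q) (\<lambda>i. Z.ext_code (Z i) r (of_nat q))" for r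
    by (rule extended_code_components[OF Z_sub S_comp])
  show ?thesis
  proof (intro conjI impI allI)
    fix r :: "'p mod_ring"
    assume q3: "q mod 4 = 3" and r: "r ^ 2 = - of_nat q"
    have r0: "r \<noteq> 0" using r q0 by auto
    have reflect: "q - j \<notin> Z i \<longleftrightarrow> j \<in> Z i" if "j \<in> {1..<q}" for i j
      using quad_residues_reflect(2)[OF q that q3] that by (auto simp: Z_def N)
    have "{j \<in> {1..<q}. q - j \<notin> Z i} = Z i" for i
      using reflect Z_sub by blast
    then have "dual_code (Suc q) (Z.ext_code (Z i) r (of_nat q)) = Z.ext_code (Z i) 1 (- r)" for i
      using Z.dual_ext_code[OF zg[of i]] by simp
    moreover have "Z.ext_code (Z i) 1 (- r) = Z.ext_code (Z i) r (of_nat q)" for i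
      using Z.ext_code_scale[OF r0, of "Z i" 1 "- r"] r by (simp add: power2_eq_square)
    ultimately have "dual_code (Suc q) (Z.ext_code (Z i) r (of_nat q)) = Z.ext_code (Z i) r (of_nat q)" for i
      by simp
    then show "self_dual (m * (q + 1)) (gray_map_vec V \<xi> ` extended_code q r S)"
      using self_dual_components[OF Z.linear_ext_code] by (simp add: ext)
  next
    assume q3: "q mod 4 = 3"
    have "Z.even_code (Z i) \<subseteq> dual_code q (Z.even_code (Z i))" for i
      by (rule Z.even_code_self_orthogonal)
        (use quad_residues_reflect(2)[OF q _ q3] in \<open>auto simp: Z_def N\<close>)
    then show "self_orthogonal (m * q) (gray_map_vec V \<xi> ` S)"
      unfolding S_comp by (rule self_orthogonal_components[OF Z.linear_even_code])
  next
    assume q1: "q mod 4 = 1"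
    obtain c where c: "c \<in> ?N" using nonresidue_exists[OF q] .
    then have c': "c \<in> {1..<q}" using sub by auto
    then have "\<not> q dvd c" by (auto dest: dvd_imp_le)
    then have "coprime c q"
      using prime_imp_coprime[OF q(1)] by (simp add: coprime_commute)
    moreover have "q - (c * j mod q) \<notin> Z i \<longleftrightarrow> j \<in> Z i" if j: "j \<in> {1..<q}" for i j
    proof -
      have k: "c * j mod q \<in> {1..<q}" using q c' j by (rule mod_mem_range)
      then have "q - c * j mod q \<in> {1..<q}" by auto
      then show ?thesis
        using quad_residues_reflect(1)[OF q k q1] quad_residues_times_nonresidue[OF q c j] k j
        unfolding Z_def N by simp
    qed
    ultimately have "formally_self_dual (m * Suc q) (gray_map_vec V \<xi> ` G.component_code (Suc q) (\<lambda>i. Z.ext_code (Z i) 1 (of_nat q)))"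
      using zg by (intro formally_self_dual_components)
    then show "formally_self_dual (m * (q + 1)) (gray_map_vec V \<xi> ` extended_code q 1 S)"
      by (simp add: ext)
  qed
qed

end
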